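(* Let $p$ be a prime number and $(k,|\cdot|)$ an ultrametric field of characteristic $p$, with ring of integers $\mathcal{O}_k$ and maximal ideal $\mathfrak{m}_k$. Let $f(\zeta)$ be a parabolic power series in $\mathcal{O}_k[[\zeta]]$, denote by $q$ the order of $f'(0)$, and assume $i_0(f^q)=q$. Then for every integer $n\ge 1$ and every periodic point $\zeta_0\in\mathfrak{m}_k$ of $f$ of minimal period $qp^n$, we have $$ |\zeta_0| \ge \begin{cases} |\delta_0(f^q)|^{\frac1q}\cdot|\operatorname{r\acute{e}sit}(f)|^{\frac{1}{qp}} & \text{if } p \text{ is odd, or if } p=2 \text{ and } n=1;\\ |\delta_0(f^q)|^{\frac1q}\cdot|\operatorname{r\acute{e}sit}(f)\,(1-\operatorname{r\acute{e}sit}(f))|^{\frac{1}{4q}} & \text{if } p=2 \text{ and } n\ge 2. \end{cases} $$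
   Context: Powers of power series denote iterates under composition. A power series $f(\zeta)\in k[[\zeta]]$ is parabolic if $f(0)=0$ and $f'(0)$ is a root of unity; its order $q$ is not divisible by $p$. For such $f$ with $f\in\mathcal{O}_k[[\zeta]]$, $f$ converges on $\mathfrak{m}_k$ (values being taken in the completion of $k$ if $k$ is not complete) and maps the maximal ideal (of the completion) to itself; periodic points and minimal periods are understood for this action. For a nonzero power series, $\operatorname{ord}$ is the lowest degree of its nonzero terms, and $\operatorname{ord}(0)=+\infty$. For $g\in k[[\zeta]]$ with $g(0)=0$, $g'(0)=1$, put $i_0(g):=\operatorname{ord}\left(\frac{g(\zeta)-\zeta}{\zeta}\right)$. When $i_0(f^q)=q$, $\delta_0(f^q)\neq 0$ denotes the coefficient of $\zeta^{q+1}$ in $f^q(\zeta)$, so $f^q(\zeta)=\zeta(1+\delta_0(f^q)\zeta^q+\cdots)$. Iterative residue $\operatorname{r\acute{e}sit}(f)\in k$ of a parabolic $f\in k[[\zeta]]$ with $i_0(f^q)=q$: (1) If $f'(0)=1$ (so $q=1$), write $f(\zeta)=\zeta(1+a_1\zeta+a_2\zeta^2+\cdots)$; then $a_1\ne0$ and $\operatorname{r\acute{e}sit}(f):=1-\frac{a_2}{a_1^2}$. (2) If $\gamma:=f'(0)\neq 1$ (so $q\ge 2$), then $f$ is conjugated (by an invertible power series in $k[[\zeta]]$ fixing $0$) to a power series of the form $g(\zeta)=\gamma\zeta\left(1+\sum_{j=1}^{+\infty}a_j\zeta^{jq}\right)$; the hypothesis $i_0(f^q)=q$ implies $a_1\neq0$,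 and $\operatorname{r\acute{e}sit}(f):=\frac{q+1}{2}-\frac{a_2}{a_1^2}$, which depends only on $f$ and not on the choice of $g$. When $p=2$ the integer $q$ is odd, so $\frac{q+1}{2}$ is an integer and defines an element of $k$. *)

theory Defs
  imports
    "HOL-Analysis.Elementary_Topology"
    "HOL-Library.Extended_Nat"
    "HOL-Computational_Algebra.Computational_Algebra"
begin

(* The library constrains norm to real vector spaces, hence the new operation absv.
   Its non-negativity and definiteness come from metric_space via dist_absv. *)
class ultrametric_field = field + metric_space +
  fixes absv :: "'a \<Rightarrow> real"
  assumes dist_absv: "dist x y = absv (x - y)"
    and absv_mult: "absv (x * y) = absv x * absv y"
    and absv_add_le_max: "absv (x + y) \<le> max (absv x) (absv y)"

class complete_ultrametric_field = ultrametric_field + complete_space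

definition is_completion ::
  "('k::ultrametric_field \<Rightarrow> 'K::complete_ultrametric_field) \<Rightarrow> bool" where
  "is_completion \<iota> \<longleftrightarrow>
     (\<forall>x y. \<iota> (x + y) = \<iota> x + \<iota> y) \<and> (\<forall>x y. \<iota> (x * y) = \<iota> x * \<iota> y) \<and> \<iota> 1 = 1 \<and>
     (\<forall>x. absv (\<iota> x) = absv x) \<and> closure (range \<iota>) = UNIV"

definition integer_ring :: "'k::ultrametric_field set" where
  "integer_ring = {x. absv x \<le> 1}"

definition maximal_ideal :: "'k::ultrametric_field set" where
  "maximal_ideal = {x. absv x < 1}"

(* The action of f on the completion. If f has coefficients in the ring of integers,
   the series converges at every z with absv z < 1; nothing is claimed elsewhere. *)
definition fps_action ::
  "('k::ultrametric_field \<Rightarrow> 'K::complete_ultrametric_field) \<Rightarrow> 'k fps \<Rightarrow> 'K \<Rightarrow> 'K" where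
  "fps_action \<iota> f z = (\<Sum>i. \<iota> (fps_nth f i) * z ^ i)"

definition has_minimal_period :: "('a \<Rightarrow> 'a) \<Rightarrow> nat \<Rightarrow> 'a \<Rightarrow> bool" where
  "has_minimal_period F m x \<longleftrightarrow>
     m > 0 \<and> (F ^^ m) x = x \<and> (\<forall>j. 0 < j \<and> j < m \<longrightarrow> (F ^^ j) x \<noteq> x)"

definition fps_iterate :: "'a::comm_ring_1 fps \<Rightarrow> nat \<Rightarrow> 'a fps" where
  "fps_iterate f n = ((\<lambda>g. f oo g) ^^ n) fps_X"

(* Unlike subdegree, takes the value infinity at the zero series. *)
definition fps_ord :: "'a::zero fps \<Rightarrow> enat" where
  "fps_ord f = (if f = 0 then \<infinity> else enat (subdegree f))"

definition i0 :: "'a::field fps \<Rightarrow> enat" where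
  "i0 g = fps_ord ((g - fps_X) / fps_X)"

definition parabolic :: "'a::field fps \<Rightarrow> bool" where
  "parabolic f \<longleftrightarrow> fps_nth f 0 = 0 \<and> (\<exists>n>0. fps_nth f 1 ^ n = 1)"

(* Meaningful only if x is a root of unity. *)
definition root_order :: "'a::field \<Rightarrow> nat" where
  "root_order x = (LEAST n. n > 0 \<and> x ^ n = 1)"

definition fps_conjugate :: "'a::field fps \<Rightarrow> 'a fps \<Rightarrow> bool" where
  "fps_conjugate f g \<longleftrightarrow>
     (\<exists>h. fps_nth h 0 = 0 \<and> fps_nth h 1 \<noteq> 0 \<and> h oo f = g oo h)"

(* The coefficient (q + 1) / 2. In characteristic 2 the number q is odd and the division
   is done in the integers. *)
definition half_succ :: "nat \<Rightarrow> 'a::field" where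
  "half_succ q =
     (if CHAR('a) = 2 then of_nat ((q + 1) div 2) else of_nat (q + 1) / 2)"

(* In the second case the normal form is g(X) = \<gamma> X (1 + \<Sum>j\<ge>1. a_j X^(j q)), written as
   \<gamma> X A(X^q) with A = 1 + a_1 X + a_2 X^2 + ...; the value does not depend on the choice of
   the conjugate g when i0 (fps_iterate f q) = q, which is the only case of interest. *)
definition resit :: "'a::field fps \<Rightarrow> 'a" where
  "resit f =
     (let \<gamma> = fps_nth f 1; q = root_order \<gamma> in
      if \<gamma> = 1 then 1 - fps_nth f 3 / (fps_nth f 2)\<^sup>2
      else (THE r. \<exists>A. fps_nth A 0 = 1 \<and>
              fps_conjugate f (fps_const \<gamma> * fps_X * (A oo fps_X ^ q)) \<and>
              r = half_succ q - fps_nth A 2 / (fps_nth A 1)\<^sup>2))"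

end

theory Submission
  imports Defs "HOL-Number_Theory.Residues"
begin

text \<open>
  Raising to the power \<open>q\<close>, composed with a conjugacy to normal form, semi-conjugates \<open>f\<close> to a
  series \<open>g = X + a X^2 + b X^3 + ...\<close> whose residue \<open>r = 1 - b / a^2\<close> is that of \<open>f\<close> divided
  by \<open>q\<close>. In characteristic \<open>p\<close> the operator \<open>D \<phi> = \<phi> \<circ> h - \<phi>\<close> satisfies
  \<open>D^p X = h^p - X\<close>, which yields the leading term of \<open>h^p - X\<close> from the first two nonlinear
  coefficients of \<open>h\<close>. For \<open>h = g^(p^n)\<close> these two coefficients determine each other, because
  \<open>h\<close> commutes with \<open>g\<close>. So the leading coefficients \<open>d n\<close> of \<open>g^(p^n) - X\<close>, in degree
  \<open>1 + (1 + p + ... + p^n)\<close>, satisfy \<open>d (n + 1) = a r (d n)^p\<close>, with \<open>r\<close> replaced by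
  \<open>1 - r\<close> when \<open>p = 2\<close> and \<open>n \<ge> 1\<close>.

  A point of minimal period \<open>q p^n\<close> is, together with its orbit, a zero of the integral series
  \<open>(f^(q p^n) - X) / (f^(q p^(n - 1)) - X)\<close>. Dividing out these \<open>q p^n\<close> zeros, all of the same
  absolute value, leaves an integral series, so the leading coefficient of the quotient is at most
  \<open>\<bar>\<zeta>\<^sub>0\<bar>^(q p^n)\<close> in absolute value.
\<close>

subsection \<open>Series tangent to the identity\<close>

text \<open>For \<open>N \<ge> 1\<close> this bounds \<open>i0 g\<close> from below by
  \<open>N\<close>. A lower bound rather than an exact order, because the next coefficient may
  vanish in characteristic \<open>p\<close>.\<close>

definition near_id :: "nat \<Rightarrow> 'a::comm_ring_1 fps \<Rightarrow> bool" where
  "near_id N g \<longleftrightarrow> (\<forall>j\<le>N. fps_nth g j = fps_nth fps_X j)"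

lemma near_id_0: "near_id N g \<Longrightarrow> fps_nth g 0 = 0"
  by (simp add: near_id_def)

lemma near_id_1: "near_id N g \<Longrightarrow> N \<ge> 1 \<Longrightarrow> fps_nth g 1 = 1"
  by (simp add: near_id_def)

lemma near_id_Suc:
  "near_id (Suc N) g \<longleftrightarrow> near_id N g \<and> fps_nth g (Suc N) = fps_nth fps_X (Suc N)"
  by (auto simp: near_id_def le_Suc_eq)

lemma near_id_factor:
  assumes "near_id N g" "N \<ge> 1"
  shows "g = fps_X * (1 + fps_X ^ N * fps_shift (N + 1) g)"
proof (rule fps_ext)
  fix n
  show "fps_nth g n = fps_nth (fps_X * (1 + fps_X ^ N * fps_shift (N + 1) g)) n"
  proof (cases "n = 0")
    case False
    then show ?thesis using assms
      by (cases "n \<le> N") (auto simp: near_id_def fps_X_power_mult_nth)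
  qed (use assms in \<open>simp add: near_id_def\<close>)
qed

text \<open>Binomial expansion \<open>1 + i X^N w + (i choose 2) X^(2N) w^2 + ...\<close>: the
  quadratic term reaches degree \<open>N + 1\<close> only for \<open>N = 1\<close>, hence the case
  distinction.\<close>

lemma one_plus_power_nth:
  fixes w :: "'a::comm_ring_1 fps"
  assumes "N \<ge> 1"
  defines "u \<equiv> 1 + fps_X ^ N * w"
  shows "(\<forall>d<N. fps_nth (u ^ i) d = (if d = 0 then 1 else 0)) \<and>
         fps_nth (u ^ i) N = of_nat i * fps_nth w 0 \<and>
         fps_nth (u ^ i) (Suc N) = of_nat i * fps_nth w 1 +
           of_nat (i choose 2) * (if N = 1 then (fps_nth w 0)\<^sup>2 else 0)"
proof (induction i)
  case 0
  then show ?case using assms by (auto simp: binomial_eq_0)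
next
  case (Suc i)
  have c0: "fps_nth (u ^ i) 0 = 1" using Suc assms by auto
  have c1: "fps_nth (u ^ i) 1 = (if N = 1 then of_nat i * fps_nth w 0 else 0)"
    using Suc assms by auto
  have w1: "fps_nth (w * u ^ i) 1 = fps_nth w 0 * fps_nth (u ^ i) 1 + fps_nth w 1"
    by (simp add: fps_mult_nth_1 c0)
  have eq: "fps_nth (u ^ Suc i) d =
      fps_nth (u ^ i) d + (if d < N then 0 else fps_nth (w * u ^ i) (d - N))" for d
  proof -
    have "u ^ Suc i = u ^ i + fps_X ^ N * (w * u ^ i)"
      by (simp add: u_def algebra_simps)
    then show ?thesis by (simp add: fps_X_power_mult_nth)
  qed
  have ch: "Suc i choose 2 = (i choose 2) + i"
    by (simp add: numeral_2_eq_2)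
  show ?case
    unfolding eq using Suc
    by (auto simp: w1 c1[simplified] c0 ch algebra_simps power2_eq_square)
qed

lemma near_id_power_nth:
  fixes g :: "'a::comm_ring_1 fps"
  assumes "near_id N g" "N \<ge> 1"
  shows "n < i + N \<Longrightarrow> fps_nth (g ^ i) n = (if n = i then 1 else 0)"
    and "fps_nth (g ^ i) (i + N) = of_nat i * fps_nth g (N + 1)"
    and "fps_nth (g ^ i) (i + N + 1) = of_nat i * fps_nth g (N + 2) +
           of_nat (i choose 2) * (if N = 1 then (fps_nth g (N + 1))\<^sup>2 else 0)"
proof -
  define w where "w = fps_shift (N + 1) g"
  have "g ^ i = fps_X ^ i * (1 + fps_X ^ N * w) ^ i"
    using near_id_factor[OF assms] unfolding w_def by (metis power_mult_distrib)
  then have *: "fps_nth (g ^ i) n = (if n < i then 0 else fps_nth ((1 + fps_X ^ N * w) ^ i) (n - i))"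
    for n by (simp add: fps_X_power_mult_nth)
  note A = one_plus_power_nth[OF assms(2), where w = w and i = i]
  show "n < i + N \<Longrightarrow> fps_nth (g ^ i) n = (if n = i then 1 else 0)"
    using A by (auto simp: *)
  show "fps_nth (g ^ i) (i + N) = of_nat i * fps_nth g (N + 1)"
    using A by (auto simp: * w_def)
  show "fps_nth (g ^ i) (i + N + 1) = of_nat i * fps_nth g (N + 2) +
           of_nat (i choose 2) * (if N = 1 then (fps_nth g (N + 1))\<^sup>2 else 0)"
    using A by (auto simp: * w_def add.commute)
qed

lemma compose_minus_nth:
  fixes g \<phi> :: "'a::comm_ring_1 fps"
  shows "fps_nth ((\<phi> oo g) - \<phi>) n = (\<Sum>i=0..n. fps_nth \<phi> i * (fps_nth (g ^ i) n - (if n = i then 1 else 0)))"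
proof -
  have "fps_nth \<phi> n = (\<Sum>i=0..n. fps_nth \<phi> i * (if n = i then 1 else 0))"
    by (subst sum.remove[of _ n]) auto
  then show ?thesis
    by (simp add: fps_compose_nth algebra_simps sum_subtractf)
qed

text \<open>The operator \<open>D \<phi> = \<phi> oo g - \<phi>\<close> raises the order by at least
  \<open>N\<close>. As \<open>g^i - X^i\<close> starts no earlier than degree \<open>i + N\<close>,
  only the coefficient \<open>m\<close> of \<phi> contributes in degree \<open>m + N\<close>, and
  only \<open>m\<close> and \<open>m + 1\<close> in the next degree.\<close>

lemma compose_near_id_nth:
  fixes g \<phi> :: "'a::comm_ring_1 fps"
  assumes g: "near_id N g" "N \<ge> 1" and \<phi>: "\<And>i. i < m \<Longrightarrow> fps_nth \<phi> i = 0"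
  shows "n < m + N \<Longrightarrow> fps_nth ((\<phi> oo g) - \<phi>) n = 0"
    and "fps_nth ((\<phi> oo g) - \<phi>) (m + N) = of_nat m * fps_nth \<phi> m * fps_nth g (N + 1)"
    and "fps_nth ((\<phi> oo g) - \<phi>) (m + N + 1) =
           (of_nat m * fps_nth g (N + 2) +
             of_nat (m choose 2) * (if N = 1 then (fps_nth g (N + 1))\<^sup>2 else 0)) * fps_nth \<phi> m +
           of_nat (m + 1) * fps_nth \<phi> (m + 1) * fps_nth g (N + 1)"
proof -
  note P = near_id_power_nth[OF g]
  have z: "fps_nth \<phi> i * (fps_nth (g ^ i) n - (if n = i then 1 else 0)) = 0"
    if "i < m \<or> n < i + N" for i n
    using that \<phi>[of i] P(1)[of n i] by auto
  show "fps_nth ((\<phi> oo g) - \<phi>) n = 0" if "n < m + N"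
    unfolding compose_minus_nth using that by (intro sum.neutral ballI z) auto
  have "fps_nth ((\<phi> oo g) - \<phi>) (m + N) =
    (\<Sum>i\<in>{m}. fps_nth \<phi> i * (fps_nth (g ^ i) (m + N) - (if m + N = i then 1 else 0)))"
    unfolding compose_minus_nth by (intro sum.mono_neutral_right ballI z) auto
  then show "fps_nth ((\<phi> oo g) - \<phi>) (m + N) = of_nat m * fps_nth \<phi> m * fps_nth g (N + 1)"
    using g P(2)[of m] by simp
  have "fps_nth ((\<phi> oo g) - \<phi>) (m + N + 1) =
    (\<Sum>i\<in>{m, m + 1}. fps_nth \<phi> i * (fps_nth (g ^ i) (m + N + 1) - (if m + N + 1 = i then 1 else 0)))"
    unfolding compose_minus_nth using g by (intro sum.mono_neutral_right ballI z) auto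
  then show "fps_nth ((\<phi> oo g) - \<phi>) (m + N + 1) =
           (of_nat m * fps_nth g (N + 2) +
             of_nat (m choose 2) * (if N = 1 then (fps_nth g (N + 1))\<^sup>2 else 0)) * fps_nth \<phi> m +
           of_nat (m + 1) * fps_nth \<phi> (m + 1) * fps_nth g (N + 1)"
    using g P(3)[of m] P(2)[of "m + 1"] by (simp add: algebra_simps)
qed

text \<open>A first deviation of \<open>g\<close> from \<open>X\<close> in degree
  \<open>j + 1\<close> shows up in degree \<open>m + j\<close> of
  \<open>\<phi> oo g - \<phi>\<close>, multiplied by \<open>m\<close> times the leading coefficient
  of \<phi>. This product is assumed nonzero since \<open>m\<close> itself could vanish in the
  field.\<close>

lemma near_id_of_compose:
  fixes g \<phi> :: "'a::field fps"
  assumes "fps_nth g 0 = 0" "fps_nth g 1 = 1"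
    and "\<And>i. i < m \<Longrightarrow> fps_nth \<phi> i = 0" and "of_nat m * fps_nth \<phi> m \<noteq> 0"
    and "N \<ge> 1" and z: "\<And>j. j < m + N \<Longrightarrow> fps_nth ((\<phi> oo g) - \<phi>) j = 0"
  shows "near_id N g"
proof -
  have "near_id j g" if "j \<le> N" for j
    using that
  proof (induction j)
    case 0
    then show ?case using assms by (simp add: near_id_def)
  next
    case (Suc j)
    show ?case
    proof (cases "j = 0")
      case True
      then show ?thesis using assms by (auto simp: near_id_def le_Suc_eq)
    next
      case False
      have "of_nat m * fps_nth \<phi> m * fps_nth g (j + 1) = 0"
        using compose_near_id_nth(2)[of j g m \<phi>] z[of "m + j"] Suc False assms by simp
      then show ?thesis using Suc False assms by (simp add: near_id_Suc fps_X_def)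
    qed
  qed
  then show ?thesis by simp
qed

section \<open>Powers of \<open>1 + D\<close> for an additive operator \<open>D\<close>\<close>

lemma unipotent_funpow:
  fixes D :: "'a::comm_ring_1 \<Rightarrow> 'a"
  assumes "\<And>x y. D (x + y) = D x + D y" and "\<And>n x. D (of_nat n * x) = of_nat n * D x"
  shows "((\<lambda>x. x + D x) ^^ m) x = (\<Sum>j\<le>m. of_nat (m choose j) * (D ^^ j) x)"
proof (induction m)
  case (Suc m)
  have D0: "D 0 = 0" using assms(2)[of 0] by simp
  have Dsum: "D (sum f A) = (\<Sum>i\<in>A. D (f i))" if "finite A" for f :: "nat \<Rightarrow> 'a" and A
    using that by (induction rule: finite_induct) (auto simp: assms(1) D0)
  have "((\<lambda>x. x + D x) ^^ Suc m) x = (\<Sum>j\<le>m. of_nat (m choose j) * (D ^^ j) x) +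
          (\<Sum>j\<le>m. of_nat (m choose j) * (D ^^ Suc j) x)"
    by (simp add: Suc Dsum assms(2))
  also have "(\<Sum>j\<le>m. of_nat (m choose j) * (D ^^ j) x) =
      (\<Sum>j\<le>Suc m. of_nat (m choose j) * (D ^^ j) x)"
    by (simp add: binomial_eq_0)
  also have "\<dots> = x + (\<Sum>j\<le>m. of_nat (m choose Suc j) * (D ^^ Suc j) x)"
    by (subst sum.atMost_Suc_shift) simp
  also have "\<dots> + (\<Sum>j\<le>m. of_nat (m choose j) * (D ^^ Suc j) x) =
      x + (\<Sum>j\<le>m. of_nat (Suc m choose Suc j) * (D ^^ Suc j) x)"
    by (simp add: sum.distrib[symmetric] algebra_simps)
  also have "\<dots> = (\<Sum>j\<le>Suc m. of_nat (Suc m choose j) * (D ^^ j) x)"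
    by (subst sum.atMost_Suc_shift) simp
  finally show ?case .
qed simp

text \<open>All inner binomial coefficients of \<open>(1 + D)^p\<close> are divisible by
  \<open>p\<close>.\<close>

lemma unipotent_funpow_CHAR:
  fixes D :: "'a::comm_ring_1 \<Rightarrow> 'a"
  assumes "\<And>x y. D (x + y) = D x + D y" and "\<And>n x. D (of_nat n * x) = of_nat n * D x"
    and "prime p" "CHAR('a) = p"
  shows "((\<lambda>x. x + D x) ^^ p) x = x + (D ^^ p) x"
proof -
  have p: "p > 0" using assms prime_gt_0_nat by blast
  have "((\<lambda>x. x + D x) ^^ p) x = (\<Sum>j\<le>p. of_nat (p choose j) * (D ^^ j) x)"
    by (rule unipotent_funpow) (use assms in auto)
  also have "\<dots> = (\<Sum>j\<in>{0, p}. of_nat (p choose j) * (D ^^ j) x)"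
  proof (intro sum.mono_neutral_right ballI)
    fix j assume "j \<in> {..p} - {0, p}"
    then have "p dvd (p choose j)"
      by (intro dvd_choose_prime) (use assms in auto)
    then have "of_nat (p choose j) = (0::'a)"
      using assms by (simp add: of_nat_eq_0_iff_char_dvd)
    then show "of_nat (p choose j) * (D ^^ j) x = 0" by simp
  qed auto
  also have "\<dots> = x + (D ^^ p) x" using p by simp
  finally show ?thesis .
qed

subsection \<open>Iterates\<close>

lemma fps_iterate_0 [simp]: "fps_iterate f 0 = fps_X"
  by (simp add: fps_iterate_def)

lemma fps_iterate_Suc: "fps_iterate f (Suc n) = f oo fps_iterate f n"
  by (simp add: fps_iterate_def)

lemma fps_iterate_nth_0 [simp]:
  "fps_nth f 0 = 0 \<Longrightarrow> fps_nth (fps_iterate f n) 0 = 0"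
  by (induction n) (auto simp: fps_iterate_Suc)

lemma fps_iterate_1 [simp]:
  "fps_nth f 0 = 0 \<Longrightarrow> fps_iterate f (Suc 0) = f"
  by (simp add: fps_iterate_Suc)

lemma fps_iterate_add:
  fixes f :: "'a::idom fps"
  assumes "fps_nth f 0 = 0"
  shows "fps_iterate f (m + n) = fps_iterate f m oo fps_iterate f n"
  using assms by (induction m) (auto simp: fps_iterate_Suc fps_compose_assoc)

lemma fps_iterate_mult:
  fixes f :: "'a::idom fps"
  assumes "fps_nth f 0 = 0"
  shows "fps_iterate f (m * n) = fps_iterate (fps_iterate f m) n"
  using assms by (induction n) (auto simp: fps_iterate_Suc fps_iterate_add)

lemma fps_iterate_commute:
  fixes f :: "'a::idom fps"
  assumes "fps_nth f 0 = 0"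
  shows "f oo fps_iterate f n = fps_iterate f n oo f"
  using fps_iterate_add[OF assms, of 1 n] fps_iterate_add[OF assms, of n 1] assms by simp

lemma fps_iterate_nth_1:
  fixes f :: "'a::idom fps"
  assumes "fps_nth f 0 = 0"
  shows "fps_nth (fps_iterate f n) 1 = fps_nth f 1 ^ n"
  by (induction n) (auto simp: fps_iterate_Suc fps_compose_nth assms)

lemma fps_iterate_semiconj:
  fixes f g h :: "'a::idom fps"
  assumes "fps_nth f 0 = 0" "fps_nth g 0 = 0" "fps_nth h 0 = 0" "h oo f = g oo h"
  shows "h oo fps_iterate f n = fps_iterate g n oo h"
proof (induction n)
  case (Suc n)
  have "h oo fps_iterate f (Suc n) = (h oo f) oo fps_iterate f n"
    using assms by (simp add: fps_iterate_Suc fps_compose_assoc)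
  also have "\<dots> = g oo (h oo fps_iterate f n)"
    using assms by (simp add: fps_compose_assoc)
  also have "\<dots> = fps_iterate g (Suc n) oo h"
    using Suc assms by (simp add: fps_iterate_Suc fps_compose_assoc)
  finally show ?case .
qed (use assms in simp)

text \<open>Leading deviations from the identity add up under composition. For \<open>m\<close>
  nonzero in the field the degree of the leading term is therefore unchanged.\<close>

lemma fps_iterate_near_id:
  fixes g :: "'a::idom fps"
  assumes "near_id N g" "N \<ge> 1"
  shows "near_id N (fps_iterate g m) \<and>
         fps_nth (fps_iterate g m) (N + 1) = of_nat m * fps_nth g (N + 1)"
proof (induction m)
  case 0
  then show ?case using assms by (simp add: near_id_def)
next
  case (Suc m)
  have g0: "fps_nth g 0 = 0" "fps_nth g 1 = 1" using assms near_id_0 near_id_1 by blast+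
  let ?h = "fps_iterate g m"
  have eq: "fps_iterate g (Suc m) = ?h oo g"
    using fps_iterate_commute[OF g0(1)] by (simp add: fps_iterate_Suc)
  have h: "fps_nth ?h i = 0" if "i < 1" for i
    using that g0 by simp
  have h1: "fps_nth ?h 1 = 1"
    using g0 by (simp add: fps_iterate_nth_1[OF g0(1)] del: One_nat_def)
  have "fps_nth (?h oo g) j = fps_nth ?h j" if "j \<le> N" for j
    using compose_near_id_nth(1)[where m = 1 and \<phi> = ?h and n = j, OF assms h] that by simp
  moreover have "fps_nth (?h oo g) (N + 1) = fps_nth ?h (N + 1) + fps_nth g (N + 1)"
    using compose_near_id_nth(2)[where m = 1 and \<phi> = ?h, OF assms h] h1 by (simp add: diff_eq_eq)
  ultimately show ?case using Suc
    unfolding eq by (auto simp: near_id_def algebra_simps)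
qed

text \<open>Composition with \<open>g\<close> on the right is linear even though \<open>g\<close> is
  not. It equals \<open>1 + D\<close>, and its \<open>m\<close>-th power sends \<open>X\<close> to
  the \<open>m\<close>-th iterate of \<open>g\<close>.\<close>

lemma iterate_CHAR:
  fixes g :: "'a::field fps"
  assumes p: "prime p" "CHAR('a) = p" and g0: "fps_nth g 0 = 0"
  shows "fps_iterate g p = fps_X + ((\<lambda>\<phi>. (\<phi> oo g) - \<phi>) ^^ p) fps_X"
proof -
  have it: "((\<lambda>\<phi>. \<phi> + ((\<phi> oo g) - \<phi>)) ^^ m) fps_X = fps_iterate g m" for m
    using fps_iterate_commute[OF g0] by (induction m) (auto simp: fps_iterate_Suc)
  have "fps_iterate g p = fps_X + ((\<lambda>\<phi>. (\<phi> oo g) - \<phi>) ^^ p) fps_X"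
    unfolding it[symmetric]
  proof (rule unipotent_funpow_CHAR)
    show "(of_nat n * \<phi> oo g) - of_nat n * \<phi> = of_nat n * ((\<phi> oo g) - \<phi>)" for n \<phi>
    proof -
      have "(of_nat n oo g) = of_nat n"
        by (simp flip: fps_of_nat)
      then show ?thesis by (simp add: fps_compose_mult_distrib[OF g0] algebra_simps)
    qed
  qed (use p in \<open>auto simp: fps_compose_add_distrib\<close>)
  then show ?thesis .
qed

lemma wilson_CHAR:
  assumes "prime p" "CHAR('a::comm_ring_1) = p"
  shows "of_nat (fact (p - 1)) = (-1 :: 'a)"
proof -
  have "[fact (p - 1) = - 1] (mod (int p))"
    using wilson_theorem[OF assms(1)] by simp
  then have "int p dvd (fact (p - 1) + 1)"
    by (simp add: cong_iff_dvd_diff add.commute)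
  then have "int p dvd int (fact (p - 1) + 1)" by (simp add: add.commute)
  then have "p dvd (fact (p - 1) + 1)" by presburger
  then have "of_nat (fact (p - 1) + 1) = (0 :: 'a)"
    using assms of_nat_eq_0_iff_char_dvd by blast
  then show ?thesis by (simp add: add.commute eq_neg_iff_add_eq_0)
qed

text \<open>With \<open>\<phi> j = D^j X\<close>, let \<alpha> and \<beta> be its coefficients in
  degrees \<open>j N + 1\<close> and \<open>j N + 2\<close>. Since \<open>N = 1\<close> in the
  field, they obey linear recursions in which \<open>\<alpha> j\<close> and \<open>\<beta> j\<close>
  carry the factors \<open>j + 1\<close> and \<open>j + 2\<close>. The factor \<open>p\<close> makes
  \<open>\<alpha> p\<close> vanish, so the first coefficient of \<open>g^p - X\<close> that can
  survive is \<open>\<beta> p\<close>.\<close>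

lemma iterate_CHAR_nth:
  fixes g :: "'a::field fps"
  assumes p: "prime p" "CHAR('a) = p"
    and g: "near_id N g" "N \<ge> 1" "of_nat N = (1::'a)"
  defines "\<delta> \<equiv> fps_nth g (N + 1)" and "\<epsilon> \<equiv> fps_nth g (N + 2)"
  defines "\<kappa> \<equiv> if N = 1 then \<delta>\<^sup>2 else 0"
  shows "near_id (p * N + 1) (fps_iterate g p)"
    and "fps_nth (fps_iterate g p) (p * N + 2) = (\<kappa> - \<epsilon>) * \<delta> ^ (p - 1)"
proof -
  define D where "D = (\<lambda>\<phi>. (\<phi> oo g) - \<phi>)"
  define \<phi> where "\<phi> = (\<lambda>j. (D ^^ j) fps_X)"
  have p2: "p \<ge> 2" using p prime_ge_2_nat by blast
  have p0: "of_nat p = (0::'a)" using p(2) by (metis of_nat_CHAR)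
  have \<phi>_Suc: "\<phi> (Suc j) = (\<phi> j oo g) - \<phi> j" for j
    by (simp add: \<phi>_def D_def)
  have low: "fps_nth (\<phi> j) i = 0" if "i < j * N + 1" for i j
    using that
  proof (induction j arbitrary: i)
    case (Suc j)
    show ?case unfolding \<phi>_Suc
      by (rule compose_near_id_nth(1)[where m = "j * N + 1", OF g(1,2) Suc.IH]) (use Suc.prems in auto)
  qed (simp add: \<phi>_def)
  define \<alpha> \<beta> where "\<alpha> = (\<lambda>j. fps_nth (\<phi> j) (j * N + 1))" and "\<beta> = (\<lambda>j. fps_nth (\<phi> j) (j * N + 2))"
  have \<alpha>0: "\<alpha> 0 = 1" "\<beta> 0 = 0" by (auto simp: \<alpha>_def \<beta>_def \<phi>_def)
  have \<alpha>S: "\<alpha> (Suc j) = of_nat (j + 1) * \<delta> * \<alpha> j" for j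
    using compose_near_id_nth(2)[where m = "j * N + 1" and \<phi> = "\<phi> j", OF g(1,2) low]
    by (simp add: \<alpha>_def \<phi>_Suc \<delta>_def g(3) algebra_simps)
  have \<beta>S: "\<beta> (Suc j) = (of_nat (j + 1) * \<epsilon> + of_nat ((j * N + 1) choose 2) * \<kappa>) * \<alpha> j +
      of_nat (j + 2) * \<delta> * \<beta> j" for j
    using compose_near_id_nth(3)[where m = "j * N + 1" and \<phi> = "\<phi> j", OF g(1,2) low]
    by (simp add: \<alpha>_def \<beta>_def \<phi>_Suc \<delta>_def \<epsilon>_def \<kappa>_def g(3) algebra_simps)
  have \<alpha>: "\<alpha> j = of_nat (fact j) * \<delta> ^ j" for j
    by (induction j) (auto simp: \<alpha>0 \<alpha>S algebra_simps)
  have wil: "of_nat (fact (p - 1)) = (-1::'a)" by (rule wilson_CHAR[OF p])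
  have \<alpha>p: "\<alpha> p = 0" using \<alpha>S[of "p - 1"] p2 p0 by simp
  have \<beta>p: "\<beta> p = (\<kappa> - \<epsilon>) * \<delta> ^ (p - 1)"
  \<comment> \<open>For \<open>p = 2\<close> two steps of the recursion from
    \<open>\<beta> 0 = 0\<close> give the value. For odd \<open>p\<close> the last two steps
    suffice: in \<open>\<beta> (p - 1)\<close> the preceding \<beta> has the factor
    \<open>p\<close>, so earlier values are forgotten.\<close>
  proof (cases "p = 2")
    case True
    have "of_nat ((1 * N + 1) choose 2) * \<kappa> = \<kappa>"
      by (cases "N = 1") (simp_all add: \<kappa>_def flip: numeral_2_eq_2)
    moreover have "(2::'a) = 0" using p0 True by simp
    moreover have "(-\<epsilon>) = \<epsilon>" using \<open>(2::'a) = 0\<close>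
      by (metis add_eq_0_iff mult_2 mult_zero_left)
    moreover have "(3::'a) = 1" using \<open>(2::'a) = 0\<close>
      by (metis add_0 numeral_plus_one one_plus_numeral semiring_norm(5) add.commute)
    moreover have "\<beta> 2 = (of_nat 2 * \<epsilon> + of_nat ((1 * N + 1) choose 2) * \<kappa>) * \<alpha> 1 + of_nat 3 * \<delta> * \<beta> 1"
      using \<beta>S[of 1] by (simp add: numeral_2_eq_2 numeral_3_eq_3 del: of_nat_Suc)
    moreover have "\<beta> 1 = \<epsilon>" using \<beta>S[of 0] by (simp add: \<alpha>0 binomial_eq_0)
    moreover have "\<alpha> 1 = \<delta>" by (simp add: \<alpha>)
    ultimately show ?thesis using True by (simp add: algebra_simps)
  next
    case False
    define s where "s = p - 3"
    have ps: "p = s + 3" using False p2 by (simp add: s_def)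
    have s3: "of_nat s + 3 = (0::'a)" using p0 by (simp add: ps)
    have two: "(2::'a) \<noteq> 0" using False p p2
      by (metis of_nat_eq_0_iff_char_dvd of_nat_numeral primes_dvd_imp_eq two_is_prime_nat)
    have c1: "of_nat ((s + 2) choose 2) * (2::'a) = 2"
    proof -
      have "((s + 2) choose 2) * 2 = (s + 2) * (s + 1)"
        using choose_two[of "s + 2"] by simp
      then have "of_nat ((s + 2) choose 2) * (2::'a) = of_nat ((s + 2) * (s + 1))"
        by (metis of_nat_mult of_nat_numeral)
      also have "\<dots> = (of_nat s + 3 - 1) * (of_nat s + 3 - 2)" by (simp add: algebra_simps)
      finally show ?thesis by (simp add: s3)
    qed
    have c1: "of_nat ((s + 2) choose 2) = (1::'a)" using c1 two by simp
    have c0: "of_nat ((s + 3) choose 2) = (0::'a)"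
    proof -
      have "(s + 3) choose 2 = ((s + 2) choose 2) + (s + 2)"
        by (simp add: numeral_2_eq_2 numeral_3_eq_3)
      then have "of_nat ((s + 3) choose 2) = 1 + (of_nat s + (2::'a))" using c1 by simp
      also have "\<dots> = of_nat s + 3" by simp
      finally show ?thesis by (simp add: s3)
    qed
    \<comment> \<open>Wilson's theorem divided by \<open>p - 1 = -1\<close> gives
      \<open>(p - 2)! = 1\<close>.\<close>
    have f1: "of_nat (fact (s + 1)) = (1::'a)"
    proof -
      have "(-1::'a) = of_nat (fact (s + 2))" using wil ps by simp
      also have "fact (s + 2) = (s + 2) * fact (s + 1)" by simp
      also have "of_nat \<dots> = (of_nat s + 3 - 1) * (of_nat (fact (s + 1)) :: 'a)" by (simp add: algebra_simps)
      finally have "-1 = - (of_nat (fact (s + 1)) :: 'a)"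
        unfolding s3 by (metis diff_0 mult_minus1)
      then show ?thesis by (metis neg_equal_iff_equal)
    qed
    have n2: "of_nat s + 2 = (-1::'a)" using s3 by (simp add: eq_neg_iff_add_eq_0 add.commute)
    have n4: "of_nat s + 4 = (1::'a)"
    proof -
      have "of_nat s + 4 = (of_nat s + 3) + (1::'a)" by simp
      then show ?thesis unfolding s3 by simp
    qed
    have "\<beta> (s + 2) = (of_nat (s + 2) * \<epsilon> + of_nat (((s + 1) * N + 1) choose 2) * \<kappa>) * \<alpha> (s + 1) +
        of_nat (s + 3) * \<delta> * \<beta> (s + 1)"
      using \<beta>S[of "s + 1"] by (simp add: numeral_2_eq_2 numeral_3_eq_3)
    also have "of_nat (((s + 1) * N + 1) choose 2) * \<kappa> = \<kappa>"
      using c1 by (simp add: \<kappa>_def)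
    also have "\<alpha> (s + 1) = \<delta> ^ (s + 1)"
      by (simp only: \<alpha> f1) simp
    finally have b2: "\<beta> (s + 2) = (\<kappa> - \<epsilon>) * \<delta> ^ (s + 1)"
      by (simp only: of_nat_add of_nat_numeral n2 s3) simp
    \<comment> \<open>In the last step \<epsilon> has the factor \<open>p\<close>, the factor of
      \<kappa> is \<open>p choose 2\<close> in the only case \<open>N = 1\<close> where \<kappa> can
      be nonzero, and \<beta> has the factor \<open>p + 1 = 1\<close>.\<close>
    have "\<beta> (s + 3) = (of_nat (s + 3) * \<epsilon> + of_nat (((s + 2) * N + 1) choose 2) * \<kappa>) * \<alpha> (s + 2) +
        of_nat (s + 4) * \<delta> * \<beta> (s + 2)"
      using \<beta>S[of "s + 2"] by (simp add: numeral_2_eq_2 numeral_3_eq_3 eval_nat_numeral)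
    also have "of_nat (((s + 2) * N + 1) choose 2) * \<kappa> = 0"
      using c0 by (simp add: \<kappa>_def numeral_3_eq_3)
    finally have "\<beta> (s + 3) = \<delta> * \<beta> (s + 2)"
      by (simp only: of_nat_add of_nat_numeral n4 s3) simp
    then have "\<beta> (s + 3) = (\<kappa> - \<epsilon>) * \<delta> ^ (s + 2)"
      unfolding b2 by simp
    then show ?thesis by (simp add: ps)
  qed
  have it: "fps_iterate g p = fps_X + \<phi> p"
    unfolding \<phi>_def D_def by (rule iterate_CHAR[OF p near_id_0[OF g(1)]])
  show "near_id (p * N + 1) (fps_iterate g p)"
    using low[of _ p] \<alpha>p by (auto simp: near_id_def it \<alpha>_def le_Suc_eq less_Suc_eq_le)
  show "fps_nth (fps_iterate g p) (p * N + 2) = (\<kappa> - \<epsilon>) * \<delta> ^ (p - 1)"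
    using \<beta>p by (simp add: it \<beta>_def)
qed


text \<open>Compares the coefficients of degree \<open>N + 3\<close> of \<open>f \<circ> g\<close> and \<open>g \<circ> f\<close>.\<close>

lemma commuting_nth:
  fixes f g :: "'a::comm_ring_1 fps"
  assumes f: "near_id 1 f" and g: "near_id N g" "N \<ge> 2" and comm: "f oo g = g oo f"
  shows "2 * fps_nth f 2 * fps_nth g (N + 2) + 3 * fps_nth f 3 * fps_nth g (N + 1) =
    (of_nat (N + 1) * fps_nth f 3 + of_nat ((N + 1) choose 2) * (fps_nth f 2)\<^sup>2) * fps_nth g (N + 1) +
    of_nat (N + 2) * fps_nth f 2 * fps_nth g (N + 2)"
proof -
  have fz: "fps_nth (f - fps_X) i = 0" if "i < 2" for i
    using f that by (simp add: near_id_def)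
  have gz: "fps_nth (g - fps_X) i = 0" if "i < N + 1" for i
    using g that by (simp add: near_id_def)
  have g0: "fps_nth f 0 = 0" "fps_nth g 0 = 0" using f g near_id_0 by blast+
  have eq: "((f - fps_X) oo g) - (f - fps_X) = ((g - fps_X) oo f) - (g - fps_X)"
    using g0 by (simp add: fps_compose_sub_distrib comm)
  have "fps_nth (((f - fps_X) oo g) - (f - fps_X)) (2 + N + 1) =
      2 * fps_nth f 2 * fps_nth g (N + 2) + 3 * fps_nth f 3 * fps_nth g (N + 1)"
    by (subst compose_near_id_nth(3)[OF g(1) _ fz]) (use g(2) in \<open>auto simp: algebra_simps numeral_3_eq_3\<close>)
  moreover have "fps_nth (((g - fps_X) oo f) - (g - fps_X)) (N + 1 + 1 + 1) =
     (of_nat (N + 1) * fps_nth f 3 + of_nat ((N + 1) choose 2) * (fps_nth f 2)\<^sup>2) * fps_nth g (N + 1) +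
     of_nat (N + 2) * fps_nth f 2 * fps_nth g (N + 2)"
    by (subst compose_near_id_nth(3)[OF f _ gz]) (use g(2) in \<open>auto simp: algebra_simps numeral_2_eq_2 numeral_3_eq_3\<close>)
  ultimately show ?thesis using eq by (simp add: numeral_3_eq_3)
qed

subsection \<open>Leading coefficients of the iterates of order \<open>p ^ n\<close>\<close>

text \<open>The lower ramification numbers of a minimally ramified series: the smallest values that
  \<open>i0\<close> can take on the iterates of order \<open>p ^ n\<close>.\<close>

definition ramif :: "nat \<Rightarrow> nat \<Rightarrow> nat" where
  "ramif p n = (\<Sum>j\<le>n. p ^ j)"

lemma ramif_0 [simp]: "ramif p 0 = 1"
  by (simp add: ramif_def)

lemma ramif_Suc: "ramif p (Suc n) = p * ramif p n + 1"
  unfolding ramif_def by (subst sum.atMost_Suc_shift) (simp add: sum_distrib_left)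

lemma ramif_Suc': "ramif p (Suc n) = ramif p n + p ^ Suc n"
  by (simp add: ramif_def)

lemma ramif_pos: "ramif p n \<ge> 1"
  by (cases n) (auto simp: ramif_Suc)

lemma of_nat_ramif: "CHAR('a::comm_ring_1) = p \<Longrightarrow> of_nat (ramif p n) = (1::'a)"
  using of_nat_CHAR[where 'a = 'a] by (cases n) (simp_all add: ramif_Suc)

text \<open>May be zero; it is the true leading coefficient of the iterate minus \<open>X\<close>
  exactly when the ramification is minimal at level \<open>n\<close>.\<close>

definition lead :: "'a::comm_ring_1 fps \<Rightarrow> nat \<Rightarrow> nat \<Rightarrow> 'a" where
  "lead f p n = fps_nth (fps_iterate f (p ^ n)) (ramif p n + 1)"

text \<open>Passing to the \<open>p\<close>-th iterate improves the contact with the identity from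
  \<open>N\<close> to at least \<open>p N + 1\<close>, and the new number is again \<open>1\<close>
  modulo \<open>p\<close>, so the step can be repeated.\<close>

lemma near_id_iterate_prime_power:
  fixes f :: "'a::field fps"
  assumes p: "prime p" "CHAR('a) = p" and f: "near_id 1 f"
  shows "near_id (ramif p n) (fps_iterate f (p ^ n))"
proof (induction n)
  case 0
  then show ?case using f near_id_0[OF f] by simp
next
  case (Suc n)
  have "fps_iterate f (p ^ Suc n) = fps_iterate (fps_iterate f (p ^ n)) p"
    using near_id_0[OF f] by (simp flip: fps_iterate_mult add: mult.commute)
  then show ?case
    using iterate_CHAR_nth(1)[OF p Suc ramif_pos of_nat_ramif[OF p(2)]]
    by (simp add: ramif_Suc)
qed

lemma lead_0: "fps_nth f 0 = 0 \<Longrightarrow> lead f p 0 = fps_nth f 2"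
  by (simp add: lead_def numeral_2_eq_2)

text \<open>The factor produced by the \<open>p\<close>-th iterate is \<kappa> - \<epsilon>. For
  \<open>n = 0\<close> it is read off from \<open>f\<close>. For \<open>n > 0\<close> one has
  \<open>N \<ge> 2\<close>, so \<kappa> vanishes, and the commutation with \<open>f\<close>
  expresses \<epsilon> through \<delta>.\<close>

lemma lead_Suc:
  fixes f :: "'a::field fps"
  assumes p: "prime p" "CHAR('a) = p" and f: "near_id 1 f"
    and a: "fps_nth f 2 \<noteq> 0"
  defines "a \<equiv> fps_nth f 2" and "r \<equiv> 1 - fps_nth f 3 / (fps_nth f 2)\<^sup>2"
  shows "lead f p (Suc n) = (if odd p \<or> n = 0 then a * r else a * (1 - r)) * lead f p n ^ p"
proof -
  define N where "N = ramif p n"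
  define g where "g = fps_iterate f (p ^ n)"
  define \<delta> where "\<delta> = fps_nth g (N + 1)"
  define \<epsilon> where "\<epsilon> = fps_nth g (N + 2)"
  have p2: "p \<ge> 2" using p prime_ge_2_nat by blast
  have f0: "fps_nth f 0 = 0" using f near_id_0 by blast
  have g: "near_id N g"
    unfolding N_def g_def by (rule near_id_iterate_prime_power[OF p f])
  have N1: "of_nat N = (1::'a)" unfolding N_def by (rule of_nat_ramif[OF p(2)])
  have it: "fps_iterate f (p ^ Suc n) = fps_iterate g p"
    using f0 by (simp add: g_def mult.commute flip: fps_iterate_mult)
  have "lead f p (Suc n) = fps_nth (fps_iterate g p) (p * N + 2)"
    by (simp only: lead_def it N_def) (simp add: ramif_Suc)
  also have "\<dots> = ((if N = 1 then \<delta>\<^sup>2 else 0) - \<epsilon>) * \<delta> ^ (p - 1)"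
    unfolding \<delta>_def \<epsilon>_def
    by (rule iterate_CHAR_nth(2)[OF p g _ N1]) (use ramif_pos[of p n] in \<open>simp add: N_def\<close>)
  also have "(if N = 1 then \<delta>\<^sup>2 else 0) - \<epsilon> =
      (if odd p \<or> n = 0 then a * r else a * (1 - r)) * \<delta>"
  proof (cases n)
    case 0
    then show ?thesis using a
      by (simp add: N_def \<delta>_def \<epsilon>_def g_def f0 a_def r_def field_simps power2_eq_square eval_nat_numeral)
  next
    case (Suc m)
    have N: "N = p * ramif p m + 1" by (simp add: N_def Suc ramif_Suc)
    have "p * ramif p m \<ge> 1 * 1" using ramif_pos[of p m] p2 by (intro mult_mono) auto
    then have N2: "N \<ge> 2" using N by simp
    have ch: "2 * ((N + 1) choose 2) = (N + 1) * N"
      using choose_two[of "N + 1"] by simp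
    \<comment> \<open>With \<open>N = 1\<close> in the field this reduces to
      \<open>a \<epsilon> = (b - C a^2) \<delta>\<close>, where \<open>b\<close> is the cubic
      coefficient of \<open>f\<close> and \<open>C\<close> is \<open>(N + 1) choose 2\<close>. The
      two cases below differ in the value of \<open>C\<close>.\<close>
    have c: "2 * a * \<epsilon> + 3 * fps_nth f 3 * \<delta> =
      (2 * fps_nth f 3 + of_nat ((N + 1) choose 2) * a\<^sup>2) * \<delta> + 3 * a * \<epsilon>"
      using commuting_nth[OF f g N2] fps_iterate_commute[OF f0] N1
      by (simp add: a_def \<delta>_def \<epsilon>_def g_def)
    have b: "fps_nth f 3 = a\<^sup>2 * (1 - r)"
      using a by (simp add: a_def r_def)
    show ?thesis
    proof (cases "odd p")
      case True
      have two: "(2::'a) \<noteq> 0" using True p p2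
        by (metis even_numeral of_nat_eq_0_iff_char_dvd of_nat_numeral primes_dvd_imp_eq two_is_prime_nat)
      have "2 * of_nat ((N + 1) choose 2) = (2::'a)"
        using arg_cong[OF ch, of "of_nat :: nat \<Rightarrow> 'a"] by (simp add: N1)
      then have "of_nat ((N + 1) choose 2) = (1::'a)" using two by simp
      then have "a * \<epsilon> + a * (a * r * \<delta>) = 0"
        using c unfolding b by (simp add: algebra_simps power2_eq_square)
      then have "a * \<epsilon> = a * (- a * r * \<delta>)"
        by (simp add: eq_neg_iff_add_eq_0)
      then have "\<epsilon> = - a * r * \<delta>" using a by (metis a_def mult_left_cancel)
      then show ?thesis using True N2 by simp
    next
      case False
      then have pe: "p = 2" using p p2 by (metis primes_dvd_imp_eq two_is_prime_nat)
      have two: "(2::'a) = 0" using p pe by (metis of_nat_CHAR of_nat_numeral)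
      \<comment> \<open>Halving is done in the naturals, using
        \<open>N + 1 = 2 (ramif p m + 1)\<close>. The factor \<open>ramif p m + 1\<close> is even,
        so here \<open>C = 0\<close>, and \<open>r\<close> is replaced by
        \<open>1 - r\<close>.\<close>
      have "2 * ((N + 1) choose 2) = 2 * ((ramif p m + 1) * N)"
        using ch N pe by simp
      then have "(N + 1) choose 2 = (ramif p m + 1) * N" by simp
      then have "of_nat ((N + 1) choose 2) = (1 + 1) * (1::'a)"
        by (simp only: of_nat_mult of_nat_add N1 of_nat_ramif[OF p(2)] of_nat_1)
      then have "of_nat ((N + 1) choose 2) = (0::'a)" using two by simp
      moreover have "(3::'a) = 1"
      proof -
        have "(3::'a) = 2 + 1" by simp
        then show ?thesis by (simp only: two add_0)
      qed
      ultimately have "a * \<epsilon> = a * (a * (1 - r) * \<delta>)"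
        using c two unfolding b by (simp add: algebra_simps power2_eq_square)
      then have "\<epsilon> = a * (1 - r) * \<delta>" using a by (simp add: a_def)
      moreover have "- x = x" for x :: 'a
        using two by (metis add_eq_0_iff mult_2 mult_zero_left)
      ultimately show ?thesis using False N2 Suc two by simp
    qed
  qed
  also have "\<delta> = lead f p n" by (simp add: \<delta>_def lead_def g_def N_def)
  finally show ?thesis using p2 by (simp flip: power_Suc)
qed

text \<open>The bound on periodic points needs quotients of consecutive leading coefficients. By the
  recursion each quotient is the \<open>p\<close>-th power of the previous one. For
  \<open>p = 2\<close> this starts one level later, because the recursion changes its factor after
  the first step. The product form remains valid when coefficients vanish.\<close>

lemma lead_ratio:
  fixes f :: "'a::field fps"
  assumes p: "prime p" "CHAR('a) = p" and f: "near_id 1 f"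
    and a: "fps_nth f 2 \<noteq> 0"
  defines "a \<equiv> fps_nth f 2" and "r \<equiv> 1 - fps_nth f 3 / (fps_nth f 2)\<^sup>2"
  shows "odd p \<or> n = 0 \<Longrightarrow> lead f p (Suc n) = a ^ (p ^ Suc n) * r ^ (p ^ n) * lead f p n"
    and "p = 2 \<Longrightarrow> lead f p (Suc (Suc n)) =
           a ^ (2 ^ Suc (Suc n)) * (r * (1 - r)) ^ (2 ^ n) * lead f p (Suc n)"
proof -
  note S = lead_Suc[OF p f a, folded r_def, folded a_def]
  have p2: "p \<ge> 2" using p prime_ge_2_nat by blast
  have l0: "lead f p 0 = a" using near_id_0[OF f] by (simp add: lead_0 a_def)
  have one: "lead f p 1 = a ^ p * r * lead f p 0"
    using S[of 0] p2 by (simp add: l0 flip: power_Suc2)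
  show "lead f p (Suc n) = a ^ (p ^ Suc n) * r ^ (p ^ n) * lead f p n" if "odd p \<or> n = 0"
    using that
  proof (induction n)
    case (Suc n)
    then have o: "odd p" by simp
    have IH: "lead f p (Suc n) = a ^ (p ^ Suc n) * r ^ (p ^ n) * lead f p n"
      using Suc o by simp
    have "lead f p (Suc (Suc n)) = a * r * lead f p (Suc n) ^ p"
      using S[of "Suc n"] o by simp
    also have "\<dots> = (a ^ (p ^ Suc n) * r ^ (p ^ n)) ^ p * (a * r * lead f p n ^ p)"
      by (subst IH) (simp add: power_mult_distrib)
    also have "a * r * lead f p n ^ p = lead f p (Suc n)"
      using S[of n] o by simp
    finally show ?case by (simp add: power_mult_distrib mult.commute flip: power_mult)
  qed (use one in simp)
  show "lead f p (Suc (Suc n)) =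
           a ^ (2 ^ Suc (Suc n)) * (r * (1 - r)) ^ (2 ^ n) * lead f p (Suc n)" if "p = 2"
  proof (induction n)
    case 0
    have "lead f p 2 = a * (1 - r) * lead f p 1 * lead f p 1"
      using S[of 1] that by (simp add: numeral_2_eq_2 mult.assoc)
    also have "\<dots> = a * (1 - r) * (a\<^sup>2 * r * a) * lead f p 1"
      using one that l0 by simp
    finally show ?case by (simp add: eval_nat_numeral algebra_simps)
  next
    case (Suc n)
    have "lead f p (Suc (Suc (Suc n))) = a * (1 - r) * lead f p (Suc (Suc n)) ^ 2"
      using S[of "Suc (Suc n)"] that by simp
    also have "\<dots> = (a ^ (2 ^ Suc (Suc n)) * (r * (1 - r)) ^ (2 ^ n)) ^ 2 *
        (a * (1 - r) * lead f p (Suc n) ^ 2)"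
      by (subst Suc.IH) (simp add: power_mult_distrib)
    also have "a * (1 - r) * lead f p (Suc n) ^ 2 = lead f p (Suc (Suc n))"
      using S[of "Suc n"] that by simp
    finally show ?case by (simp add: power_mult_distrib mult.commute flip: power_mult)
  qed
qed

subsection \<open>Normal forms and the iterative residue\<close>

lemma power_subdegree_nth:
  fixes h :: "'a::comm_ring_1 fps"
  assumes "\<And>i. i < m \<Longrightarrow> fps_nth h i = 0"
  shows "k < m * i \<Longrightarrow> fps_nth (h ^ i) k = 0"
    and "fps_nth (h ^ i) (m * i) = fps_nth h m ^ i"
proof -
  have "h = fps_X ^ m * fps_shift m h"
    by (rule fps_ext) (use assms in \<open>auto simp: fps_X_power_mult_nth\<close>)
  then have "h ^ i = fps_X ^ (m * i) * fps_shift m h ^ i"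
    by (metis power_mult_distrib power_mult)
  then show "k < m * i \<Longrightarrow> fps_nth (h ^ i) k = 0"
    and "fps_nth (h ^ i) (m * i) = fps_nth h m ^ i"
    by (simp_all add: fps_X_power_mult_nth fps_power_zeroth)
qed

text \<open>Leading terms are compared in \<open>(H oo F) - H = (G - X) oo H\<close>: the right side
  starts no earlier than degree \<open>m (s + 1)\<close>, and the left side starts at
  \<open>m\<close> plus the contact order of \<open>F\<close>, as long as \<open>m\<close> is
  nonzero in the field.\<close>

lemma near_id_semiconj:
  fixes F G H :: "'a::field fps"
  assumes F: "fps_nth F 0 = 0" "fps_nth F 1 = 1"
    and H: "\<And>i. i < m \<Longrightarrow> fps_nth H i = 0" "of_nat m * fps_nth H m \<noteq> 0"
    and eq: "H oo F = G oo H" and G: "near_id s G" "s \<ge> 1"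
  shows "near_id (m * s) F"
    and "of_nat m * fps_nth F (m * s + 1) = fps_nth G (s + 1) * fps_nth H m ^ s"
proof -
  have m: "m \<ge> 1" using H(2) by (cases m) auto
  have H0: "fps_nth H 0 = 0" using H(1) m by simp
  have Gz: "fps_nth (G - fps_X) i = 0" if "i < s + 1" for i
    using that G by (simp add: near_id_def)
  have D: "(H oo F) - H = (G - fps_X) oo H"
    using H0 by (simp add: eq fps_compose_sub_distrib)
  have z: "fps_nth ((H oo F) - H) j = 0" if "j < m + m * s" for j
    unfolding D fps_compose_nth
  proof (intro sum.neutral ballI)
    fix i
    have "fps_nth (H ^ i) j = 0" if "\<not> i < s + 1"
    proof (rule power_subdegree_nth(1)[OF H(1)])
      have "m * (s + 1) \<le> m * i" using that by (intro mult_le_mono) auto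
      then show "j < m * i" using \<open>j < m + m * s\<close> by simp
    qed
    then show "fps_nth (G - fps_X) i * fps_nth (H ^ i) j = 0"
      using Gz[of i] by fastforce
  qed
  show nF: "near_id (m * s) F"
    by (rule near_id_of_compose[OF F H _ z]) (use m G in auto)
  have "fps_nth ((H oo F) - H) (m + m * s) = (\<Sum>i\<in>{s + 1}. fps_nth (G - fps_X) i * fps_nth (H ^ i) (m + m * s))"
    unfolding D fps_compose_nth
  proof (intro sum.mono_neutral_right ballI)
    show "{s + 1} \<subseteq> {0..m + m * s}" using mult_le_mono1[OF m, of "s + 1"] by simp
    fix i assume i: "i \<in> {0..m + m * s} - {s + 1}"
    have "fps_nth (H ^ i) (m + m * s) = 0" if "\<not> i < s + 1"
    proof (rule power_subdegree_nth(1)[OF H(1)])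
      have "m * (s + 2) \<le> m * i" using that i by (intro mult_le_mono) auto
      then show "m + m * s < m * i" using m by (simp add: algebra_simps)
    qed
    then show "fps_nth (G - fps_X) i * fps_nth (H ^ i) (m + m * s) = 0"
      using Gz[of i] by fastforce
  qed auto
  also have "\<dots> = fps_nth G (s + 1) * fps_nth H m ^ (s + 1)"
    using power_subdegree_nth(2)[of m H "s + 1"] H(1) G(2) by simp
  also have "fps_nth ((H oo F) - H) (m + m * s) = of_nat m * fps_nth H m * fps_nth F (m * s + 1)"
    by (rule compose_near_id_nth(2)[OF nF _ H(1)]) (use m G in auto)
  finally have "fps_nth H m * (of_nat m * fps_nth F (m * s + 1)) =
      fps_nth H m * (fps_nth G (s + 1) * fps_nth H m ^ s)"
    by (simp add: mult_ac)
  then show "of_nat m * fps_nth F (m * s + 1) = fps_nth G (s + 1) * fps_nth H m ^ s"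
    using H(2) by simp
qed

section \<open>Formal conjugation to normal form\<close>

lemma power_nth_cong:
  fixes b b' :: "'a::comm_ring_1 fps"
  assumes "\<And>j. j \<le> n \<Longrightarrow> fps_nth b j = fps_nth b' j"
  shows "j \<le> n \<Longrightarrow> fps_nth (b ^ i) j = fps_nth (b' ^ i) j"
proof (induction i arbitrary: j)
  case (Suc i)
  then show ?case using assms by (simp add: fps_mult_nth)
qed simp

lemma compose_nth_cong:
  fixes b b' :: "'a::comm_ring_1 fps"
  assumes "\<And>j. j \<le> n \<Longrightarrow> fps_nth a j = fps_nth a' j" "\<And>j. j \<le> n \<Longrightarrow> fps_nth b j = fps_nth b' j"
  shows "fps_nth (a oo b) n = fps_nth (a' oo b') n"
  using assms power_nth_cong[OF assms(2)] by (simp add: fps_compose_nth)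

text \<open>For \<open>i \<ge> 2\<close> the top coefficient of \<open>b\<close> would have to be
  multiplied by the constant term, which is zero. Hence the unknown coefficient of \<open>h\<close>
  enters \<open>g oo h\<close> only through the linear term of \<open>g\<close>.\<close>

lemma power_nth_cong_strict:
  fixes b b' :: "'a::comm_ring_1 fps"
  assumes "\<And>j. j < n \<Longrightarrow> fps_nth b j = fps_nth b' j" "fps_nth b 0 = 0" "fps_nth b' 0 = 0" "i \<ge> 2"
  shows "fps_nth (b ^ i) n = fps_nth (b' ^ i) n"
proof (cases "n = 0")
  case False
  obtain k where k: "i = Suc k" "k \<ge> 1" using assms(4) by (cases i) auto
  have c: "fps_nth (b ^ k) j = fps_nth (b' ^ k) j" if "j < n" for j
    by (rule power_nth_cong[where n = "n - 1"]) (use that assms(1) in auto)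
  have "fps_nth (b ^ k) 0 = 0" "fps_nth (b' ^ k) 0 = 0" using k assms by (auto simp: fps_power_zeroth power_0_left)
  then have "fps_nth b j * fps_nth (b ^ k) (n - j) = fps_nth b' j * fps_nth (b' ^ k) (n - j)" if "j \<le> n" for j
    using c[of "n - j"] assms(1)[of j] assms(2,3) that by (cases "j = 0"; cases "j = n") auto
  then show ?thesis by (simp add: k fps_mult_nth)
qed (use assms in \<open>simp add: fps_power_zeroth power_0_left\<close>)

lemma root_order:
  assumes "n > 0" "x ^ n = 1"
  shows "root_order x > 0" "x ^ root_order x = 1"
  using LeastI[of "\<lambda>n. n > 0 \<and> x ^ n = 1" n] assms by (auto simp: root_order_def)

lemma root_order_dvd:
  fixes x :: "'a::field"
  assumes "n > 0" "x ^ n = 1" "x ^ k = 1"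
  shows "root_order x dvd k"
proof (rule ccontr)
  let ?q = "root_order x"
  assume "\<not> ?q dvd k"
  then have pos: "k mod ?q > 0" by (simp add: dvd_eq_mod_eq_0)
  have "x ^ k = x ^ (?q * (k div ?q) + k mod ?q)" by simp
  also have "\<dots> = x ^ (k mod ?q)"
    using root_order(2)[OF assms(1,2)] by (simp only: power_add power_mult) simp
  finally have "x ^ (k mod ?q) = 1" using assms by simp
  then have "?q \<le> k mod ?q" using pos unfolding root_order_def by (intro Least_le) auto
  then show False using mod_less_divisor[of ?q k] root_order(1)[OF assms(1,2)] by linarith
qed

lemma root_order_1 [simp]: "root_order 1 = 1"
  unfolding root_order_def by (intro Least_equality) auto

text \<open>If the order were \<open>p k\<close>, then \<open>(x^k - 1)^p = x^(p k) - 1 = 0\<close>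
  would make the order at most \<open>k\<close>.\<close>

lemma root_order_coprime_CHAR:
  fixes x :: "'a::field"
  assumes "prime p" "CHAR('a) = p" "n > 0" "x ^ n = 1"
  shows "\<not> p dvd root_order x"
proof
  assume "p dvd root_order x"
  then obtain k where k: "root_order x = p * k" by auto
  have kpos: "k > 0" using root_order(1)[OF assms(3,4)] k by (cases k) auto
  have "(x ^ k - 1) ^ p + 1 ^ p = ((x ^ k - 1) + 1) ^ p"
    using freshmans_dream[where 'a = 'a] assms(1,2) by metis
  also have "\<dots> = 1" using root_order(2)[OF assms(3,4)] k by (simp add: mult.commute flip: power_mult)
  finally have "x ^ k = 1" by simp
  then have "root_order x dvd k" by (rule root_order_dvd[OF assms(3,4)])
  then have "root_order x \<le> k" using kpos by (rule dvd_imp_le)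
  moreover have "p * k \<ge> 2 * k" using assms(1) prime_ge_2_nat by simp
  ultimately show False using k kpos by simp
qed

text \<open>The two series are found degree by degree: in a degree congruent to \<open>1\<close> modulo \<open>q\<close> the
  coefficient of \<open>g\<close> is free, in any other degree that of \<open>h\<close> is.\<close>

lemma resonant_conjugate_exists:
  fixes f :: "'a::field fps"
  assumes f0: "fps_nth f 0 = 0" and res: "\<And>n. n mod q \<noteq> 1 \<Longrightarrow> fps_nth f 1 ^ n \<noteq> fps_nth f 1"
    and q: "q \<ge> 2"
  obtains h g where "fps_nth h 0 = 0" "fps_nth h 1 = 1" "h oo f = g oo h"
    "fps_nth g 1 = fps_nth f 1" "\<And>n. n mod q \<noteq> 1 \<Longrightarrow> fps_nth g n = 0"
proof -
  define \<gamma> where "\<gamma> = fps_nth f 1"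
  \<comment> \<open>Coefficients below \<open>n\<close> are those already chosen and
    \<open>x\<close> is the candidate in degree \<open>n\<close>. Cutting off above \<open>n\<close>
    makes the condition \<open>P\<close> depend on earlier choices only, as well-founded choice
    requires.\<close>
  define trunc where "trunc = (\<lambda>(c :: nat \<Rightarrow> 'a) n x. Abs_fps (\<lambda>i. if i < n then c i else if i = n then x else 0))"
  define P where "P = (\<lambda>(\<phi> :: nat \<Rightarrow> 'a \<times> 'a) n r.
    (let H = trunc (fst \<circ> \<phi>) n (fst r); G = trunc (snd \<circ> \<phi>) n (snd r) in
      fps_nth (H oo f) n = fps_nth (G oo H) n \<and> (n mod q \<noteq> 1 \<longrightarrow> snd r = 0) \<and>
      (n = 0 \<longrightarrow> fst r = 0) \<and> (n = 1 \<longrightarrow> r = (1, \<gamma>))))"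
  have "\<exists>\<phi>. \<forall>n. P \<phi> n (\<phi> n)"
  proof (rule dependent_wellorder_choice)
    fix r and \<phi> \<psi> :: "nat \<Rightarrow> 'a \<times> 'a" and n :: nat
    assume eq: "\<And>y. y < n \<Longrightarrow> \<phi> y = \<psi> y"
    have "trunc (fst \<circ> \<phi>) n x = trunc (fst \<circ> \<psi>) n x" "trunc (snd \<circ> \<phi>) n x = trunc (snd \<circ> \<psi>) n x" for x
      using eq by (auto simp: trunc_def fps_eq_iff)
    then show "P \<phi> n r = P \<psi> n r" by (simp add: P_def)
  next
    fix n and \<phi> :: "nat \<Rightarrow> 'a \<times> 'a"
    assume IH: "\<And>y. y < n \<Longrightarrow> P \<phi> y (\<phi> y)"
    show "\<exists>r. P \<phi> n r"
    proof (cases "n < 2")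
      case True
      then consider "n = 0" | "n = 1" by linarith
      then show ?thesis
      proof cases
        case 1
        then have "P \<phi> n (0, 0)" using q by (simp add: P_def Let_def trunc_def)
        then show ?thesis by blast
      next
        case 2
        have "P \<phi> 0 (\<phi> 0)" using IH 2 by simp
        then have "\<phi> 0 = (0, 0)" using q by (simp add: P_def Let_def prod_eq_iff)
        then have "P \<phi> n (1, \<gamma>)" using q 2
          by (simp add: P_def Let_def trunc_def fps_compose_nth \<gamma>_def)
        then show ?thesis by blast
      qed
    next
      case n: False
      have "P \<phi> 0 (\<phi> 0)" "P \<phi> 1 (\<phi> 1)" using IH n by simp_all
      then have \<phi>01: "\<phi> 0 = (0, 0)" "\<phi> 1 = (1, \<gamma>)" using q by (simp_all add: P_def Let_def prod_eq_iff)
      define H G where "H = trunc (fst \<circ> \<phi>) n" and "G = trunc (snd \<circ> \<phi>) n"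
      have H01: "fps_nth (H x) 0 = 0" "fps_nth (H x) 1 = 1" and G1: "fps_nth (G x) 1 = \<gamma>" for x
        using n \<phi>01 by (auto simp: H_def G_def trunc_def)
      define e where "e = fps_nth (G 0 oo H 0) n - fps_nth (H 0 oo f) n"
      have Hf: "fps_nth (H x oo f) n = fps_nth (H 0 oo f) n + x * \<gamma> ^ n" for x
      proof -
        have "fps_nth (f ^ n) n = \<gamma> ^ n"
          using power_subdegree_nth(2)[of 1 f n] f0 by (simp add: \<gamma>_def)
        then have "fps_nth (H x) i * fps_nth (f ^ i) n =
            fps_nth (H 0) i * fps_nth (f ^ i) n + (if i = n then x * \<gamma> ^ n else 0)" if "i \<le> n" for i
          using that by (auto simp: H_def trunc_def)
        then show ?thesis by (simp add: fps_compose_nth sum.distrib)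
      qed
      have GH: "fps_nth (G y oo H x) n = fps_nth (G 0 oo H 0) n + x * \<gamma> + y" for x y
      proof -
        have Hi: "fps_nth (H x ^ i) n = fps_nth (H 0 ^ i) n" if "i \<ge> 2" for i
          by (rule power_nth_cong_strict) (use that H01 in \<open>auto simp: H_def trunc_def\<close>)
        have Hn: "fps_nth (H x ^ n) n = 1"
          using power_subdegree_nth(2)[of 1 "H x" n] H01 by simp
        have "fps_nth (G y) i * fps_nth (H x ^ i) n =
            fps_nth (G 0) i * fps_nth (H 0 ^ i) n + (if i = 1 then x * \<gamma> else 0) + (if i = n then y else 0)"
          if "i \<le> n" for i
        proof -
          have "i = 0 \<or> i = 1 \<or> (i \<ge> 2 \<and> i < n) \<or> (i = n \<and> i \<ge> 2)" using that n by arith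
          then consider "i = 0" | "i = 1" | "i \<ge> 2" "i < n" | "i = n" "i \<ge> 2" by blast
          then show ?thesis
          proof cases
            case 2
            then show ?thesis using n G1 by (simp add: H_def trunc_def)
          next
            case 3
            then show ?thesis using Hi[of i] by (simp add: G_def trunc_def)
          next
            case 4
            then show ?thesis using Hi[of i] Hn by (simp add: G_def trunc_def)
          qed (use n in \<open>simp add: G_def trunc_def\<close>)
        qed
        then have "fps_nth (G y oo H x) n = (\<Sum>i=0..n. fps_nth (G 0) i * fps_nth (H 0 ^ i) n +
            (if i = 1 then x * \<gamma> else 0) + (if i = n then y else 0))"
          unfolding fps_compose_nth by (intro sum.cong) auto
        then show ?thesis using n
          by (simp add: sum.distrib fps_compose_nth)
      qed
      \<comment> \<open>The new coefficient \<open>x\<close> of \<open>h\<close> contributes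
        \<open>x \<gamma>^n\<close> to \<open>h oo f\<close> and \<open>x \<gamma>\<close> to
        \<open>g oo h\<close>, so the condition is one linear equation, solvable with
        \<open>y = 0\<close> unless \<open>\<gamma>^n = \<gamma>\<close>.\<close>
      have P_iff: "P \<phi> n (x, y) \<longleftrightarrow> x * (\<gamma> ^ n - \<gamma>) = e + y \<and> (n mod q \<noteq> 1 \<longrightarrow> y = 0)" for x y
      proof -
        have "P \<phi> n (x, y) \<longleftrightarrow> fps_nth (H x oo f) n = fps_nth (G y oo H x) n \<and> (n mod q \<noteq> 1 \<longrightarrow> y = 0)"
          using n by (simp add: P_def Let_def H_def G_def)
        also have "fps_nth (H x oo f) n = fps_nth (G y oo H x) n \<longleftrightarrow> x * (\<gamma> ^ n - \<gamma>) = e + y"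
          unfolding Hf[of x] GH[of y x] e_def by (auto simp: algebra_simps)
        finally show ?thesis .
      qed
      show ?thesis
      proof (cases "n mod q = 1")
        case True
        then have "P \<phi> n (0, - e)" by (simp add: P_iff)
        then show ?thesis by blast
      next
        case False
        then have "P \<phi> n (e / (\<gamma> ^ n - \<gamma>), 0)" using res[of n] by (simp add: P_iff \<gamma>_def)
        then show ?thesis by blast
      qed
    qed
  qed
  then obtain \<phi> where \<phi>: "\<And>n. P \<phi> n (\<phi> n)" by blast
  define h g where "h = Abs_fps (fst \<circ> \<phi>)" and "g = Abs_fps (snd \<circ> \<phi>)"
  have "h oo f = g oo h"
  proof (rule fps_ext)
    fix n
    have "fps_nth (trunc (fst \<circ> \<phi>) n (fst (\<phi> n)) oo f) n =
        fps_nth (trunc (snd \<circ> \<phi>) n (snd (\<phi> n)) oo trunc (fst \<circ> \<phi>) n (fst (\<phi> n))) n"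
      using \<phi>[of n] by (simp add: P_def Let_def)
    moreover have "fps_nth (trunc (fst \<circ> \<phi>) n (fst (\<phi> n)) oo f) n = fps_nth (h oo f) n"
      by (rule compose_nth_cong) (auto simp: h_def trunc_def)
    moreover have "fps_nth (trunc (snd \<circ> \<phi>) n (snd (\<phi> n)) oo trunc (fst \<circ> \<phi>) n (fst (\<phi> n))) n = fps_nth (g oo h) n"
      by (rule compose_nth_cong) (auto simp: h_def g_def trunc_def)
    ultimately show "fps_nth (h oo f) n = fps_nth (g oo h) n" by simp
  qed
  moreover have "fps_nth h 0 = 0" "fps_nth h 1 = 1" "fps_nth g 1 = fps_nth f 1"
    using \<phi>[of 0] \<phi>[of 1] by (simp_all add: P_def Let_def h_def g_def \<gamma>_def)
  moreover have "fps_nth g n = 0" if "n mod q \<noteq> 1" for n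
    using \<phi>[of n] that by (simp add: P_def Let_def g_def)
  ultimately show ?thesis using that by blast
qed

text \<open>The resonant degrees, those with \<open>\<gamma>^m = \<gamma>\<close>, are congruent to
  \<open>1\<close> modulo \<open>q\<close>. A series supported in such degrees is
  \<open>\<gamma> X A(X^q)\<close>.\<close>

lemma normal_form_exists:
  fixes f :: "'a::field fps"
  assumes f0: "fps_nth f 0 = 0" and n: "n > 0" "fps_nth f 1 ^ n = 1" and ne: "fps_nth f 1 \<noteq> 1"
  shows "\<exists>A. fps_nth A 0 = 1 \<and>
    fps_conjugate f (fps_const (fps_nth f 1) * fps_X * (A oo fps_X ^ root_order (fps_nth f 1)))"
proof -
  define \<gamma> where "\<gamma> = fps_nth f 1"
  define q where "q = root_order \<gamma>"
  have \<gamma>0: "\<gamma> \<noteq> 0" using n by (auto simp: \<gamma>_def power_0_left)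
  have q0: "q > 0" "\<gamma> ^ q = 1" using root_order n unfolding q_def \<gamma>_def by auto
  have q2: "q \<ge> 2"
  proof -
    have "q \<noteq> 1" using q0 ne by (auto simp: \<gamma>_def)
    then show ?thesis using q0 by linarith
  qed
  have res: "\<gamma> ^ m \<noteq> \<gamma>" if "m mod q \<noteq> 1" for m
  proof
    assume eq: "\<gamma> ^ m = \<gamma>"
    show False
    proof (cases m)
      case 0
      then show ?thesis using eq ne by (simp add: \<gamma>_def)
    next
      case (Suc k)
      then have "\<gamma> ^ k = 1" using eq \<gamma>0 by simp
      then have "q dvd k" using root_order_dvd n unfolding q_def \<gamma>_def by blast
      then obtain l where "k = q * l" by auto
      then have "m mod q = 1" using Suc q2 by (simp add: mod_Suc)
      then show False using that by simp
    qed
  qed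
  obtain h g where hg: "fps_nth h 0 = 0" "fps_nth h 1 = 1" "h oo f = g oo h"
    "fps_nth g 1 = \<gamma>" "\<And>m. m mod q \<noteq> 1 \<Longrightarrow> fps_nth g m = 0"
    using resonant_conjugate_exists[OF f0 res[unfolded \<gamma>_def] q2] unfolding \<gamma>_def by blast
  define A where "A = Abs_fps (\<lambda>j. fps_nth g (j * q + 1) / \<gamma>)"
  have "g = fps_const \<gamma> * fps_X * (A oo fps_X ^ q)"
  proof (rule fps_ext)
    fix m
    have "fps_nth g 0 = 0" using hg(5)[of 0] by simp
    moreover have "fps_nth g (Suc k) = \<gamma> * fps_nth (A oo fps_X ^ q) k" for k
    proof (cases "q dvd k")
      case True
      then show ?thesis using \<gamma>0 q0 by (simp add: fps_nth_compose_X_power A_def)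
    next
      case False
      have "Suc k mod q \<noteq> 1"
      proof
        assume "Suc k mod q = 1"
        then have "[k + 1 = 0 + 1] (mod q)" using q2 by (simp add: cong_def)
        then have "[k = 0] (mod q)" by (simp only: cong_add_rcancel_nat)
        then show False using False by (simp add: cong_0_iff)
      qed
      then show ?thesis using hg(5) False q0 by (simp add: fps_nth_compose_X_power)
    qed
    ultimately show "fps_nth g m = fps_nth (fps_const \<gamma> * fps_X * (A oo fps_X ^ q)) m"
      by (cases m) (simp_all add: mult.assoc)
  qed
  moreover have "fps_nth A 0 = 1" using hg(4) \<gamma>0 by (simp add: A_def)
  ultimately show ?thesis
    using hg(1-3) unfolding fps_conjugate_def \<gamma>_def[symmetric] q_def[symmetric] by (metis one_neq_zero)
qed

text \<open>A semi-conjugacy of order \<open>q\<close> multiplies contact orders by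
  \<open>q\<close>. Passing from \<open>g^(p^n)\<close> to its \<open>q\<close>-th iterate
  multiplies the leading coefficient by \<open>q\<close>, which cancels the factor \<open>q\<close>
  on the side of \<open>f\<close>.\<close>

lemma semiconj_lead:
  fixes f g H :: "'a::field fps"
  assumes p: "prime p" "CHAR('a) = p"
    and f: "fps_nth f 0 = 0" "fps_nth f 1 ^ q = 1" and q: "of_nat q \<noteq> (0::'a)"
    and H: "\<And>i. i < q \<Longrightarrow> fps_nth H i = 0" "fps_nth H q \<noteq> 0"
    and eq: "H oo f = g oo H" and g: "near_id 1 g"
  shows "near_id (q * ramif p n) (fps_iterate f (q * p ^ n))"
    and "fps_nth (fps_iterate f (q * p ^ n)) (q * ramif p n + 1) =
      lead g p n * fps_nth H q ^ ramif p n"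
proof -
  have q0: "q > 0" using q by (cases q) auto
  have g0: "fps_nth g 0 = 0" using g near_id_0 by blast
  have F1: "fps_nth (fps_iterate f (q * p ^ n)) 1 = 1"
    using f by (simp add: fps_iterate_nth_1 power_mult del: One_nat_def)
  have G: "fps_iterate g (q * p ^ n) = fps_iterate (fps_iterate g (p ^ n)) q"
    using g0 by (simp add: mult.commute flip: fps_iterate_mult)
  note N = fps_iterate_near_id[OF near_id_iterate_prime_power[OF p g] ramif_pos, of n q, folded G]
  have sc: "H oo fps_iterate f (q * p ^ n) = fps_iterate g (q * p ^ n) oo H"
    by (rule fps_iterate_semiconj[OF f(1) g0 _ eq]) (use H q0 in auto)
  have qH: "of_nat q * fps_nth H q \<noteq> 0" using q H by simp
  have F0: "fps_nth (fps_iterate f (q * p ^ n)) 0 = 0" using f by simp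
  note T = near_id_semiconj[OF F0 F1 H(1) qH sc conjunct1[OF N] ramif_pos]
  show "near_id (q * ramif p n) (fps_iterate f (q * p ^ n))" by (rule T(1))
  have "of_nat q * fps_nth (fps_iterate f (q * p ^ n)) (q * ramif p n + 1) =
      of_nat q * (lead g p n * fps_nth H q ^ ramif p n)"
    using T(2) N by (simp add: lead_def mult.assoc)
  then show "fps_nth (fps_iterate f (q * p ^ n)) (q * ramif p n + 1) =
      lead g p n * fps_nth H q ^ ramif p n"
    using q by simp
qed

text \<open>The witness is \<open>h^q\<close>. As \<open>\<gamma>^q = 1\<close>, the
  \<open>q\<close>-th power of \<open>\<gamma> X A(X^q)\<close> is \<open>X A^q\<close> evaluated at
  \<open>X^q\<close>, which is tangent to the identity.\<close>

lemma normal_form_semiconj: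
  fixes f A :: "'a::field fps"
  assumes f0: "fps_nth f 0 = 0" and A: "fps_nth A 0 = 1" and \<gamma>: "\<gamma> ^ q = 1" "q > 0"
    and conj: "fps_conjugate f (fps_const \<gamma> * fps_X * (A oo fps_X ^ q))"
  obtains H where "\<And>i. i < q \<Longrightarrow> fps_nth H i = 0" "fps_nth H q \<noteq> 0"
    "H oo f = (fps_X * A ^ q) oo H"
proof -
  obtain h where h: "fps_nth h 0 = 0" "fps_nth h 1 \<noteq> 0"
    "h oo f = (fps_const \<gamma> * fps_X * (A oo fps_X ^ q)) oo h"
    using conj unfolding fps_conjugate_def by blast
  have Xq: "fps_nth (fps_X ^ q :: 'a fps) 0 = 0" using \<gamma> by simp
  have "h ^ q oo f = (h oo f) ^ q" by (rule fps_compose_power[OF f0, symmetric])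
  also have "\<dots> = (fps_const \<gamma> * fps_X * (A oo fps_X ^ q)) ^ q oo h"
    unfolding h(3) by (rule fps_compose_power[OF h(1)])
  also have "(fps_const \<gamma> * fps_X * (A oo fps_X ^ q)) ^ q = fps_X ^ q * (A oo fps_X ^ q) ^ q"
    using \<gamma> by (simp add: power_mult_distrib fps_const_power)
  also have "\<dots> = (fps_X * A ^ q) oo fps_X ^ q"
    using Xq by (simp add: fps_compose_mult_distrib fps_compose_power)
  also have "((fps_X * A ^ q) oo fps_X ^ q) oo h = (fps_X * A ^ q) oo (fps_X ^ q oo h)"
    by (rule fps_compose_assoc[symmetric]) (use h Xq in auto)
  also have "fps_X ^ q oo h = h ^ q"
    using h(1) by (simp flip: fps_compose_power)
  finally have "h ^ q oo f = (fps_X * A ^ q) oo h ^ q" .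
  moreover have "fps_nth (h ^ q) i = 0" if "i < q" for i
    using power_subdegree_nth(1)[of 1 h i q] h that by simp
  moreover have "fps_nth (h ^ q) q \<noteq> 0"
    using power_subdegree_nth(2)[of 1 h q] h by simp
  ultimately show ?thesis using that by blast
qed

lemma normal_form_power_nth:
  fixes A :: "'a::comm_ring_1 fps"
  assumes "fps_nth A 0 = 1"
  shows "near_id 1 (fps_X * A ^ q)"
    and "fps_nth (fps_X * A ^ q) 2 = of_nat q * fps_nth A 1"
    and "fps_nth (fps_X * A ^ q) 3 = of_nat q * fps_nth A 2 + of_nat (q choose 2) * (fps_nth A 1)\<^sup>2"
proof -
  have n: "near_id 1 (fps_X * A)" using assms by (auto simp: near_id_def le_Suc_eq)
  have eq: "fps_nth ((fps_X * A) ^ q) (q + k) = fps_nth (A ^ q) k" for k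
    by (simp add: power_mult_distrib fps_X_power_mult_nth)
  show "near_id 1 (fps_X * A ^ q)" using assms by (auto simp: near_id_def le_Suc_eq fps_power_zeroth)
  show "fps_nth (fps_X * A ^ q) 2 = of_nat q * fps_nth A 1"
    using near_id_power_nth(2)[OF n, of q] eq[of 1] by simp
  show "fps_nth (fps_X * A ^ q) 3 = of_nat q * fps_nth A 2 + of_nat (q choose 2) * (fps_nth A 1)\<^sup>2"
    using near_id_power_nth(3)[OF n, of q] eq[of 2] by (simp add: numeral_2_eq_2)
qed

text \<open>The left side equals \<open>q - (q choose 2) / q - a_2 / a_1^2\<close>, so the claim
  reduces to \<open>q - (q choose 2) / q = (q + 1) / 2\<close>. In characteristic 2, writing
  \<open>q = 2 m + 1\<close> replaces the division by two.\<close>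

lemma half_succ_residue:
  fixes A :: "'a::field fps"
  assumes p: "prime p" "CHAR('a) = p" and q: "\<not> p dvd q" and A: "fps_nth A 0 = 1" "fps_nth A 1 \<noteq> 0"
  defines "g \<equiv> fps_X * A ^ q"
  shows "of_nat q * (1 - fps_nth g 3 / (fps_nth g 2)\<^sup>2) = half_succ q - fps_nth A 2 / (fps_nth A 1)\<^sup>2"
proof -
  have q0: "of_nat q \<noteq> (0::'a)" using p q by (simp add: of_nat_eq_0_iff_char_dvd)
  note g = normal_form_power_nth[OF A(1), of q, folded g_def]
  have "of_nat q * (1 - fps_nth g 3 / (fps_nth g 2)\<^sup>2) =
      of_nat q - of_nat (q choose 2) / of_nat q - fps_nth A 2 / (fps_nth A 1)\<^sup>2"
    unfolding g using q0 A(2) by (simp add: field_simps power2_eq_square)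
  also have "of_nat q - of_nat (q choose 2) / of_nat q = (half_succ q :: 'a)"
  proof (cases "p = 2")
    case True
    then obtain m where m: "q = 2 * m + 1" using q by (metis oddE)
    have two: "(2::'a) = 0" using p True by (metis of_nat_CHAR of_nat_numeral)
    have "q choose 2 = m * q" using m by (simp add: choose_two)
    moreover have q1: "of_nat q = (1::'a)" using m two by simp
    ultimately have "of_nat (q choose 2) = (of_nat m :: 'a)" by simp
    moreover have "- x = x" for x :: 'a
      using two by (metis add_eq_0_iff mult_2 mult_zero_left)
    then have "1 - of_nat m = (1 + of_nat m :: 'a)" by (metis diff_conv_add_uminus)
    moreover have "half_succ q = (1 + of_nat m :: 'a)"
      using p True by (simp add: half_succ_def m)
    ultimately show ?thesis by (simp only: q1 div_by_1)
  next
    case False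
    then have two: "(2::'a) \<noteq> 0" using p
      by (metis of_nat_eq_0_iff_char_dvd of_nat_numeral primes_dvd_imp_eq two_is_prime_nat)
    have q1: "q \<ge> 1" using q by (cases q) auto
    have "even (q * (q - 1))" by auto
    then have "2 * (q choose 2) = q * (q - 1)" by (simp only: choose_two dvd_mult_div_cancel)
    then have "2 * of_nat (q choose 2) = (of_nat q * (of_nat q - 1) :: 'a)"
      by (metis of_nat_mult of_nat_numeral of_nat_diff of_nat_1 q1)
    then have "of_nat (q choose 2) = of_nat q * (of_nat q - 1) / (2 :: 'a)"
      using two by (simp add: field_simps)
    then have "of_nat q - of_nat (q choose 2) / of_nat q = of_nat q - (of_nat q - 1) / (2::'a)"
      using q0 by simp
    also have "\<dots> = half_succ q"
      using p False two by (simp add: half_succ_def field_simps)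
    finally show ?thesis .
  qed
  finally show ?thesis .
qed

lemma i0_eq_imp:
  fixes F :: "'a::field fps"
  assumes "i0 F = enat q" "fps_nth F 0 = 0" "q > 0"
  shows "near_id q F" "fps_nth F (q + 1) \<noteq> 0"
proof -
  define s where "s = (F - fps_X) / fps_X"
  have s: "s \<noteq> 0" "subdegree s = q"
    using assms by (auto simp: i0_def fps_ord_def s_def split: if_splits)
  \<comment> \<open>The quotient in \<open>i0\<close> is exact because \<open>F\<close> has no
    constant term.\<close>
  have "fps_X dvd F - fps_X"
  proof
    show "F - fps_X = fps_X * fps_shift 1 (F - fps_X)"
      by (rule fps_ext) (use assms in auto)
  qed
  then have Fs: "F - fps_X = fps_X * s"
    unfolding s_def by (rule dvd_mult_div_cancel[symmetric])
  have nth: "fps_nth F n = fps_nth fps_X n + (if n = 0 then 0 else fps_nth s (n - 1))" for n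
  proof -
    have "fps_nth (F - fps_X) n = (if n = 0 then 0 else fps_nth s (n - 1))"
      unfolding Fs by (rule fps_X_mult_nth)
    then show ?thesis by (simp only: fps_sub_nth) (metis add.commute diff_add_cancel)
  qed
  show "near_id q F"
    unfolding near_id_def
  proof (intro allI impI)
    fix j assume "j \<le> q"
    then have "fps_nth s (j - 1) = 0" if "j \<noteq> 0"
      using that s(2) by (intro nth_less_subdegree_zero) simp
    then show "fps_nth F j = fps_nth fps_X j" by (simp only: nth) simp
  qed
  have "fps_nth s q \<noteq> 0" using s nth_subdegree_nonzero[of s] by simp
  then show "fps_nth F (q + 1) \<noteq> 0"
    using nth[of "q + 1"] assms(3) by simp
qed


text \<open>In every normal form the residue equals the same expression in leading coefficients of
  iterates of \<open>f\<close>; this is why the description in \<open>resit\<close> is unambiguous.\<close>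

lemma parabolic_lead:
  fixes f :: "'a::field fps"
  assumes p: "prime p" "CHAR('a) = p" and f: "parabolic f" and q: "q = root_order (fps_nth f 1)"
    and i0: "i0 (fps_iterate f q) = enat q"
  obtains g c where "near_id 1 g" "fps_nth g 2 \<noteq> 0" "c \<noteq> 0"
    "of_nat q * (1 - fps_nth g 3 / (fps_nth g 2)\<^sup>2) = resit f"
    "\<And>n. near_id (q * ramif p n) (fps_iterate f (q * p ^ n))"
    "\<And>n. fps_nth (fps_iterate f (q * p ^ n)) (q * ramif p n + 1) = lead g p n * c ^ ramif p n"
proof -
  define \<gamma> where "\<gamma> = fps_nth f 1"
  obtain n where f0: "fps_nth f 0 = 0" and n: "n > 0" "\<gamma> ^ n = 1"
    using f unfolding parabolic_def \<gamma>_def by blast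
  have q0: "q > 0" "\<gamma> ^ q = 1" and pq: "\<not> p dvd q"
    using root_order[OF n] root_order_coprime_CHAR[OF p n] by (auto simp: q \<gamma>_def)
  have qn: "of_nat q \<noteq> (0::'a)" using p pq by (simp add: of_nat_eq_0_iff_char_dvd)
  define D where "D = (\<lambda>n. fps_nth (fps_iterate f (q * p ^ n)) (q * ramif p n + 1))"
  have D0: "D 0 \<noteq> 0" using i0_eq_imp(2)[OF i0] f0 q0 by (simp add: D_def)
  show ?thesis
  proof (cases "\<gamma> = 1")
    case True
    then have q1: "q = 1" by (simp add: q \<gamma>_def)
    have f1: "near_id 1 f" using f0 True by (auto simp: near_id_def le_Suc_eq \<gamma>_def)
    have D: "D n = lead f p n" for n by (simp add: D_def lead_def q1)
    show ?thesis
    proof (rule that[of f 1])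
      show "fps_nth f 2 \<noteq> 0" using D0 f0 by (simp add: D lead_0)
      show "of_nat q * (1 - fps_nth f 3 / (fps_nth f 2)\<^sup>2) = resit f"
        using True by (simp add: q1 resit_def \<gamma>_def)
      show "near_id (q * ramif p n) (fps_iterate f (q * p ^ n))" for n
        using near_id_iterate_prime_power[OF p f1, of n] by (simp add: q1)
      show "fps_nth (fps_iterate f (q * p ^ n)) (q * ramif p n + 1) = lead f p n * 1 ^ ramif p n" for n
        using D[of n] by (simp add: D_def)
    qed (use f1 in auto)
  next
    case False
    define nf where "nf = (\<lambda>A. fps_nth A 0 = 1 \<and> fps_conjugate f (fps_const \<gamma> * fps_X * (A oo fps_X ^ q)))"
    have red: "\<exists>H. (\<forall>i<q. fps_nth H i = 0) \<and> fps_nth H q \<noteq> 0 \<and> H oo f = (fps_X * A ^ q) oo H"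
      if "nf A" for A
      using normal_form_semiconj[OF f0 _ q0(2,1), of A] that unfolding nf_def by metis
    have main: "\<exists>c. near_id 1 (fps_X * A ^ q) \<and> fps_nth (fps_X * A ^ q) 2 \<noteq> 0 \<and> c \<noteq> 0 \<and>
       (\<forall>n. near_id (q * ramif p n) (fps_iterate f (q * p ^ n)) \<and> D n = lead (fps_X * A ^ q) p n * c ^ ramif p n) \<and>
       fps_nth A 1 \<noteq> 0"
      if A: "nf A" for A
    proof -
      obtain H where H: "\<And>i. i < q \<Longrightarrow> fps_nth H i = 0" "fps_nth H q \<noteq> 0" "H oo f = (fps_X * A ^ q) oo H"
        using red[OF A] by blast
      have A0: "fps_nth A 0 = 1" using A by (simp add: nf_def)
      note g = normal_form_power_nth[OF A0, of q]
      have L: "near_id (q * ramif p n) (fps_iterate f (q * p ^ n))"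
        "D n = lead (fps_X * A ^ q) p n * fps_nth H q ^ ramif p n" for n
        unfolding D_def using semiconj_lead[OF p f0 q0(2)[unfolded \<gamma>_def] qn H g(1)] by blast+
      have "fps_nth (fps_X * A ^ q) 2 \<noteq> 0"
        using L(2)[of 0] D0 by (auto simp: lead_0)
      then show ?thesis using L H(2) g by (metis mult_zero_right)
    qed
    have residue: "half_succ q - fps_nth A 2 / (fps_nth A 1)\<^sup>2 = of_nat q * (D 1 / D 0 ^ (p + 1))"
      if A: "nf A" for A
    proof -
      define g where "g = fps_X * A ^ q"
      obtain c where c: "near_id 1 g" "fps_nth g 2 \<noteq> 0" "c \<noteq> 0" "\<And>n. D n = lead g p n * c ^ ramif p n" "fps_nth A 1 \<noteq> 0"
        using main[OF A] unfolding g_def by blast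
      have l0: "lead g p 0 = fps_nth g 2" using near_id_0[OF c(1)] by (simp add: lead_0)
      have r1: "ramif p 1 = p + 1" by (simp add: ramif_Suc)
      have "lead g p 1 = fps_nth g 2 ^ (p + 1) * (1 - fps_nth g 3 / (fps_nth g 2)\<^sup>2)"
        using lead_ratio(1)[OF p c(1,2), of 0] by (simp add: l0)
      \<comment> \<open>The constant \<open>c\<close> occurs to the power \<open>p + 1\<close> on
        both sides, so the residue depends on \<open>f\<close> alone.\<close>
      then have "D 1 = D 0 ^ (p + 1) * (1 - fps_nth g 3 / (fps_nth g 2)\<^sup>2)"
        unfolding c(4) r1 by (simp add: l0 power_mult_distrib)
      then have "1 - fps_nth g 3 / (fps_nth g 2)\<^sup>2 = D 1 / D 0 ^ (p + 1)"
        using D0 by simp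
      moreover have "of_nat q * (1 - fps_nth g 3 / (fps_nth g 2)\<^sup>2) = half_succ q - fps_nth A 2 / (fps_nth A 1)\<^sup>2"
        unfolding g_def by (rule half_succ_residue[OF p pq]) (use A c in \<open>auto simp: nf_def\<close>)
      ultimately show ?thesis by simp
    qed
    obtain A where A: "nf A"
      using normal_form_exists[OF f0] n False unfolding nf_def q \<gamma>_def by blast
    have "resit f = (THE r. \<exists>A. nf A \<and> r = half_succ q - fps_nth A 2 / (fps_nth A 1)\<^sup>2)"
      using False unfolding resit_def nf_def by (simp add: \<gamma>_def q Let_def conj_assoc)
    also have "\<dots> = half_succ q - fps_nth A 2 / (fps_nth A 1)\<^sup>2"
      by (rule the_equality) (use A residue in auto)
    finally have res: "resit f = half_succ q - fps_nth A 2 / (fps_nth A 1)\<^sup>2" .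
    obtain c where c: "near_id 1 (fps_X * A ^ q)" "fps_nth (fps_X * A ^ q) 2 \<noteq> 0" "c \<noteq> 0"
      "\<And>n. near_id (q * ramif p n) (fps_iterate f (q * p ^ n))"
      "\<And>n. D n = lead (fps_X * A ^ q) p n * c ^ ramif p n" "fps_nth A 1 \<noteq> 0"
      using main[OF A] by blast
    show ?thesis
      by (rule that[OF c(1-3) _ c(4) c(5)[unfolded D_def]])
        (use A res half_succ_residue[OF p pq _ c(6)] in \<open>simp add: nf_def\<close>)
  qed
qed

subsection \<open>Integral power series over an ultrametric field\<close>

context ultrametric_field
begin

lemma absv_nonneg [simp]: "absv x \<ge> 0"
  using dist_absv[of x 0] zero_le_dist[of x 0] by simp

lemma absv_eq_0_iff [simp]: "absv x = 0 \<longleftrightarrow> x = 0"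
  using dist_absv[of x 0] dist_eq_0_iff[of x 0] by simp

lemma absv_pos: "x \<noteq> 0 \<Longrightarrow> absv x > 0"
  using absv_nonneg[of x] absv_eq_0_iff[of x] by linarith

lemma absv_0 [simp]: "absv 0 = 0"
  by simp

lemma absv_1 [simp]: "absv 1 = 1"
  using absv_mult[of 1 1] absv_eq_0_iff[of 1] by simp

lemma absv_minus [simp]: "absv (- x) = absv x"
  using dist_absv[of 0 x] dist_absv[of x 0] dist_commute[of x 0] by simp

lemma absv_diff_commute: "absv (x - y) = absv (y - x)"
  using absv_minus[of "x - y"] by simp

lemma absv_diff_le_max: "absv (x - y) \<le> max (absv x) (absv y)"
  using absv_add_le_max[of x "- y"] by simp

lemma absv_power: "absv (x ^ n) = absv x ^ n"
  by (induction n) (auto simp: absv_mult)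

lemma absv_divide: "absv (x / y) = absv x / absv y"
proof (cases "y = 0")
  case False
  then have "absv x = absv (x / y) * absv y" by (simp flip: absv_mult)
  then show ?thesis using False by (simp add: field_simps)
qed simp

lemma absv_prod: "finite A \<Longrightarrow> absv (prod g A) = (\<Prod>a\<in>A. absv (g a))"
  by (induction rule: finite_induct) (auto simp: absv_mult)

lemma absv_sum_le:
  assumes "B \<ge> 0" "\<And>a. a \<in> A \<Longrightarrow> absv (g a) \<le> B"
  shows "absv (sum g A) \<le> B"
  using assms(2)
proof (induction A rule: infinite_finite_induct)
  case (insert a A)
  then have "absv (g a) \<le> B" "absv (sum g A) \<le> B" by auto
  then show ?case using insert.hyps absv_add_le_max[of "g a" "sum g A"] by simp
qed (use assms(1) in auto)

lemma absv_of_power_eq_1: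
  assumes "x ^ n = 1" "n > 0"
  shows "absv x = 1"
proof -
  have "absv x ^ n = 1 ^ n" using absv_power[of x n] assms by simp
  then show ?thesis using assms(2) power_eq_imp_eq_base[of "absv x" n 1] by simp
qed

end

definition integral_fps :: "'a::ultrametric_field fps \<Rightarrow> bool" where
  "integral_fps F \<longleftrightarrow> (\<forall>i. absv (fps_nth F i) \<le> 1)"

lemma integral_fps_nth: "integral_fps F \<Longrightarrow> absv (fps_nth F i) \<le> 1"
  by (simp add: integral_fps_def)

lemma integral_fps_add: "integral_fps F \<Longrightarrow> integral_fps G \<Longrightarrow> integral_fps (F + G)"
  unfolding integral_fps_def fps_add_nth by (meson absv_add_le_max max.boundedI order_trans)

lemma integral_fps_diff: "integral_fps F \<Longrightarrow> integral_fps G \<Longrightarrow> integral_fps (F - G)"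
  unfolding integral_fps_def fps_sub_nth by (meson absv_diff_le_max max.boundedI order_trans)

lemma integral_fps_const: "absv c \<le> 1 \<Longrightarrow> integral_fps (fps_const c)"
  by (simp add: integral_fps_def)

lemma integral_fps_0 [simp]: "integral_fps 0" and integral_fps_1 [simp]: "integral_fps 1"
  and integral_fps_X [simp]: "integral_fps fps_X"
  by (simp_all add: integral_fps_def)

lemma integral_fps_mult:
  assumes "integral_fps F" "integral_fps G"
  shows "integral_fps (F * G)"
  unfolding integral_fps_def fps_mult_nth
proof (intro allI absv_sum_le)
  show "absv (fps_nth F i * fps_nth G (n - i)) \<le> 1" for i n
    using assms by (simp add: absv_mult integral_fps_def mult_le_one)
qed simp

lemma integral_fps_power: "integral_fps F \<Longrightarrow> integral_fps (F ^ n)"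
  by (induction n) (auto intro: integral_fps_mult)

lemma integral_fps_sum: "(\<And>a. a \<in> A \<Longrightarrow> integral_fps (F a)) \<Longrightarrow> integral_fps (sum F A)"
  by (induction A rule: infinite_finite_induct) (auto intro: integral_fps_add)

lemma integral_fps_compose:
  assumes "integral_fps F" "integral_fps G"
  shows "integral_fps (F oo G)"
  unfolding integral_fps_def fps_compose_nth
proof (intro allI absv_sum_le)
  show "absv (fps_nth F i * fps_nth (G ^ i) n) \<le> 1" for i n
    using assms integral_fps_power[OF assms(2), of i]
    by (simp add: absv_mult integral_fps_def mult_le_one)
qed simp

lemma integral_fps_iterate: "integral_fps F \<Longrightarrow> integral_fps (fps_iterate F n)"
  by (induction n) (auto simp: fps_iterate_Suc integral_fps_compose)

text \<open>The cofactor is built from \<open>P^i - X^i = (P - X) S i\<close>. Division in the field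
  would not show integrality, since the leading coefficient of \<open>P - X\<close> may have
  absolute value below 1.\<close>

lemma integral_compose_minus_dvd:
  assumes F: "integral_fps F" and P: "integral_fps P" "fps_nth P 0 = 0"
  obtains E where "integral_fps E" "(F oo P) - F = (P - fps_X) * E"
proof -
  define S where "S = (\<lambda>i. \<Sum>l<i. fps_X ^ (i - Suc l) * P ^ l)"
  \<comment> \<open>\<open>S i\<close> has order at least \<open>i - 1\<close>, so terms with
    \<open>i > m + 1\<close> contribute nothing in degree \<open>m\<close>.\<close>
  define E where "E = Abs_fps (\<lambda>m. \<Sum>i=0..m+1. fps_nth F i * fps_nth (S i) m)"
  have SI: "integral_fps (S i)" for i
    unfolding S_def by (intro integral_fps_sum integral_fps_mult integral_fps_power P integral_fps_X)
  have S0: "fps_nth (S i) m = 0" if "m + 1 < i" for i m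
  proof -
    have "fps_nth (fps_X ^ (i - Suc l) * P ^ l) m = 0" if "l < i" for l
    proof -
      have "fps_nth (P ^ l) k = 0" if "k < l" for k
        using startsby_zero_power_prefix[OF P(2)] that by blast
      then show ?thesis using \<open>m + 1 < i\<close> \<open>l < i\<close> by (auto simp: fps_X_power_mult_nth)
    qed
    then show ?thesis by (simp add: S_def fps_sum_nth)
  qed
  have SP: "(P - fps_X) * S i = P ^ i - fps_X ^ i" for i
    unfolding S_def by (simp add: power_diff_sumr2)
  have EI: "integral_fps E"
    unfolding integral_fps_def E_def fps_nth_Abs_fps
  proof (intro allI absv_sum_le)
    show "absv (fps_nth F i * fps_nth (S i) m) \<le> 1" for i m
      using F SI[of i] by (simp add: absv_mult integral_fps_def mult_le_one)
  qed simp
  have "(F oo P) - F = (P - fps_X) * E"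
  proof (rule fps_ext)
    fix n
    have "fps_nth E m = (\<Sum>i=0..n+1. fps_nth F i * fps_nth (S i) m)" if "m \<le> n" for m
      unfolding E_def fps_nth_Abs_fps using that S0[of m]
      by (intro sum.mono_neutral_left) auto
    then have "fps_nth ((P - fps_X) * E) n =
        (\<Sum>j=0..n. fps_nth (P - fps_X) j * (\<Sum>i=0..n+1. fps_nth F i * fps_nth (S i) (n - j)))"
      by (simp add: fps_mult_nth)
    also have "\<dots> = (\<Sum>i=0..n+1. fps_nth F i * fps_nth ((P - fps_X) * S i) n)"
      by (simp only: sum_distrib_left fps_mult_nth) (subst sum.swap, simp only: mult_ac)
    also have "\<dots> = (\<Sum>i=0..n. fps_nth F i * (fps_nth (P ^ i) n - (if n = i then 1 else 0)))"
      using startsby_zero_power_prefix[OF P(2), of "Suc n"] by (simp add: SP)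
    also have "\<dots> = fps_nth ((F oo P) - F) n" by (rule compose_minus_nth[symmetric])
    finally show "fps_nth ((F oo P) - F) n = fps_nth ((P - fps_X) * E) n" by simp
  qed
  then show ?thesis using EI that by blast
qed

text \<open>Telescoping: each difference of consecutive iterates is an integral multiple of
  \<open>P - X\<close>.\<close>

lemma integral_iterate_minus_dvd:
  assumes P: "integral_fps P" "fps_nth P 0 = 0"
  shows "\<exists>h. integral_fps h \<and> fps_iterate P j - fps_X = (P - fps_X) * h"
proof (induction j)
  case 0
  then show ?case by (intro exI[of _ 0]) simp
next
  case (Suc j)
  then obtain h where h: "integral_fps h" "fps_iterate P j - fps_X = (P - fps_X) * h" by blast
  obtain E where E: "integral_fps E" "(fps_iterate P j oo P) - fps_iterate P j = (P - fps_X) * E"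
    using integral_compose_minus_dvd[OF integral_fps_iterate[OF P(1)] P] by blast
  have "fps_iterate P (Suc j) - fps_X =
      ((fps_iterate P j oo P) - fps_iterate P j) + (fps_iterate P j - fps_X)"
    using fps_iterate_commute[OF P(2), of j] by (simp add: fps_iterate_Suc)
  also have "\<dots> = (P - fps_X) * (E + h)"
    unfolding E(2) h(2) by (simp add: algebra_simps)
  finally have "fps_iterate P (Suc j) - fps_X = (P - fps_X) * (E + h)" .
  then show ?case using E h integral_fps_add by blast
qed


text \<open>The value of an integral series at a point of the open unit disc is the remainder of its
  division by \<open>X - z\<close>. With this definition, products and compositions need no rearrangement of
  infinite sums.\<close>

definition has_value :: "'a::ultrametric_field \<Rightarrow> 'a fps \<Rightarrow> 'a \<Rightarrow> bool" where
  "has_value z F c \<longleftrightarrow> (\<exists>U. integral_fps U \<and> F = fps_const c + (fps_X - fps_const z) * U)"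

text \<open>Integrality of the cofactor is essential, because \<open>X - z\<close> is a unit among
  formal series for \<open>z \<noteq> 0\<close>. Comparing coefficients gives
  \<open>absv (d - c) \<le> absv z ^ Suc m\<close> for every \<open>m\<close>.\<close>

lemma has_value_unique:
  assumes "has_value z F c" "has_value z F d" "absv z < 1"
  shows "c = d"
proof -
  obtain U V where UV: "integral_fps U" "integral_fps V" "F = fps_const c + (fps_X - fps_const z) * U"
    "F = fps_const d + (fps_X - fps_const z) * V"
    using assms unfolding has_value_def by blast
  define W where "W = U - V"
  have W: "integral_fps W" unfolding W_def by (rule integral_fps_diff[OF UV(1,2)])
  have eq: "fps_const (d - c) = (fps_X - fps_const z) * W"
    using UV(3,4) by (simp add: W_def algebra_simps flip: fps_const_sub)
  have nth: "fps_nth (fps_const (d - c)) m = (if m = 0 then 0 else fps_nth W (m - 1)) - z * fps_nth W m" for m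
    unfolding eq by (simp add: left_diff_distrib)
  have "d - c = - (z ^ Suc m * fps_nth W m)" for m
  proof (induction m)
    case 0
    then show ?case using nth[of 0] by simp
  next
    case (Suc m)
    have "fps_nth W m = z * fps_nth W (Suc m)" using nth[of "Suc m"] by simp
    then show ?case using Suc by (simp add: mult_ac)
  qed
  then have le: "absv (d - c) \<le> absv z ^ Suc m" for m
    using integral_fps_nth[OF W, of m]
    by (metis absv_minus absv_mult absv_nonneg absv_power mult_left_le zero_le_power)
  have "(\<lambda>m. absv z ^ Suc m) \<longlonglongrightarrow> 0"
    using assms(3) by (intro LIMSEQ_Suc LIMSEQ_power_zero) simp
  then have "absv (d - c) \<le> 0"
    using le by (intro LIMSEQ_le_const) auto
  then show ?thesis using absv_nonneg[of "d - c"] by (simp add: order_antisym)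
qed

lemma has_value_integral:
  assumes "has_value z F c" "integral_fps F" "absv z \<le> 1"
  shows "absv c \<le> 1"
proof -
  obtain U where U: "integral_fps U" "F = fps_const c + (fps_X - fps_const z) * U"
    using assms unfolding has_value_def by blast
  have "c = fps_nth F 0 + z * fps_nth U 0"
    by (simp add: U(2))
  moreover have "absv (z * fps_nth U 0) \<le> 1"
    using integral_fps_nth[OF U(1)] assms(3) by (simp add: absv_mult mult_le_one)
  ultimately show ?thesis
    using integral_fps_nth[OF assms(2), of 0] absv_add_le_max[of "fps_nth F 0" "z * fps_nth U 0"] by simp
qed

lemma has_value_const: "has_value z (fps_const c) c"
  unfolding has_value_def by (intro exI[of _ 0]) simp

lemma has_value_X: "has_value z fps_X z"
  unfolding has_value_def by (intro exI[of _ 1]) simp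

lemma has_value_diff:
  assumes "has_value z F c" "has_value z G d"
  shows "has_value z (F - G) (c - d)"
proof -
  obtain U V where UV: "integral_fps U" "integral_fps V" "F = fps_const c + (fps_X - fps_const z) * U"
    "G = fps_const d + (fps_X - fps_const z) * V"
    using assms unfolding has_value_def by blast
  have "F - G = fps_const (c - d) + (fps_X - fps_const z) * (U - V)"
    by (simp add: UV(3,4) algebra_simps flip: fps_const_sub)
  then show ?thesis using integral_fps_diff[OF UV(1,2)] unfolding has_value_def by blast
qed

lemma has_value_mult:
  assumes "has_value z F c" "has_value z G d" "integral_fps F" "integral_fps G" "absv z \<le> 1"
  shows "has_value z (F * G) (c * d)"
proof -
  obtain U V where UV: "integral_fps U" "integral_fps V" "F = fps_const c + (fps_X - fps_const z) * U"
    "G = fps_const d + (fps_X - fps_const z) * V"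
    using assms unfolding has_value_def by blast
  have "F * G = fps_const c * G + (fps_X - fps_const z) * (U * G)"
    by (subst UV(3)) (simp add: algebra_simps)
  also have "\<dots> = fps_const (c * d) + (fps_X - fps_const z) * (fps_const c * V + U * G)"
    by (subst (1) UV(4)) (simp add: algebra_simps flip: fps_const_mult)
  finally have eq: "F * G = fps_const (c * d) + (fps_X - fps_const z) * (fps_const c * V + U * G)" .
  have "integral_fps (fps_const c * V + U * G)"
    by (intro integral_fps_add integral_fps_mult integral_fps_const UV assms has_value_integral[OF assms(1)])
  then show ?thesis using eq unfolding has_value_def by blast
qed

lemma has_value_compose:
  assumes "has_value w F c" "has_value z G w" "integral_fps G" "fps_nth G 0 = 0"
  shows "has_value z (F oo G) c"
proof -
  obtain U V where UV: "integral_fps U" "integral_fps V" "F = fps_const c + (fps_X - fps_const w) * U"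
    "G = fps_const w + (fps_X - fps_const z) * V"
    using assms unfolding has_value_def by blast
  have "F oo G = fps_const c + (G - fps_const w) * (U oo G)"
    using assms(4) by (simp add: UV(3) fps_compose_add_distrib fps_compose_sub_distrib fps_compose_mult_distrib)
  also have "G - fps_const w = (fps_X - fps_const z) * V"
    using UV(4) by simp
  finally have "F oo G = fps_const c + (fps_X - fps_const z) * (V * (U oo G))" by (simp add: mult.assoc)
  then show ?thesis
    using integral_fps_mult[OF UV(2) integral_fps_compose[OF UV(1) assms(3)]]
    unfolding has_value_def by blast
qed

text \<open>The constant terms give \<open>c = z U_0\<close>, and the linear terms give
  \<open>F_1 = U_0 - z U_1\<close>. Since \<open>absv z < 1\<close>, the ultrametric inequality
  forces \<open>absv U_0 = 1\<close>.\<close>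

lemma has_value_isometry:
  assumes "has_value z F c" "integral_fps F" "fps_nth F 0 = 0" "absv (fps_nth F 1) = 1" "absv z < 1"
  shows "absv c = absv z"
proof -
  obtain U where U: "integral_fps U" "F = fps_const c + (fps_X - fps_const z) * U"
    using assms unfolding has_value_def by blast
  have c: "c = z * fps_nth U 0"
    using assms(3) by (simp add: U(2))
  have "fps_nth F 1 = fps_nth U 0 - z * fps_nth U 1"
    by (simp add: U(2) left_diff_distrib)
  then have "1 \<le> max (absv (fps_nth U 0)) (absv (z * fps_nth U 1))"
    using absv_diff_le_max[of "fps_nth U 0" "z * fps_nth U 1"] assms(4) by simp
  moreover have "absv (z * fps_nth U 1) < 1"
    using integral_fps_nth[OF U(1), of 1] assms(5)
    by (metis absv_mult absv_nonneg mult_left_le order_le_less_trans)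
  ultimately have "absv (fps_nth U 0) = 1"
    using integral_fps_nth[OF U(1), of 0] by linarith
  then show ?thesis by (simp add: c absv_mult)
qed

text \<open>Links the algebraic value to the convergent sum. The cofactor consists of the rescaled
  tails of the series, and these are integral by the ultrametric inequality.\<close>

lemma has_value_suminf:
  fixes F :: "'a::complete_ultrametric_field fps"
  assumes F: "integral_fps F" and z: "absv z < 1" "z \<noteq> 0"
  shows "has_value z F (\<Sum>i. fps_nth F i * z ^ i)"
proof -
  define s where "s = (\<lambda>N. \<Sum>i<N. fps_nth F i * z ^ i)"
  have tail: "absv (s N - s M) \<le> absv z ^ M" if "M \<le> N" for M N
  proof -
    have "s N - s M = (\<Sum>i\<in>{M..<N}. fps_nth F i * z ^ i)"
      unfolding s_def using that sum_diff_nat_ivl[of 0 M N "\<lambda>i. fps_nth F i * z ^ i"]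
      by (simp add: atLeast0LessThan)
    also have "absv \<dots> \<le> absv z ^ M"
    proof (rule absv_sum_le)
      fix i assume "i \<in> {M..<N}"
      then have "absv z ^ i \<le> absv z ^ M" using z by (intro power_decreasing) auto
      moreover have "absv (fps_nth F i) * absv z ^ i \<le> 1 * absv z ^ i"
        by (intro mult_right_mono integral_fps_nth F) simp
      ultimately show "absv (fps_nth F i * z ^ i) \<le> absv z ^ M"
        by (simp add: absv_mult absv_power)
    qed simp
    finally show ?thesis .
  qed
  have small: "\<exists>M. \<forall>N\<ge>M. absv z ^ N < e" if "e > 0" for e
    using LIMSEQ_power_zero[of "absv z"] z that by (simp add: LIMSEQ_iff)
  have "Cauchy s"
  proof (rule metric_CauchyI)
    fix e :: real assume "e > 0"
    then obtain M where M: "\<And>N. N \<ge> M \<Longrightarrow> absv z ^ N < e" using small by blast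
    have "dist (s m) (s n) < e" if "m \<ge> M" "n \<ge> M" for m n
    proof -
      have "dist (s m) (s n) \<le> absv z ^ min m n"
        using tail[of m n] tail[of n m] absv_diff_commute[of "s m" "s n"]
        by (simp add: dist_absv min_def)
      also have "\<dots> < e" using M that by (simp add: min_def)
      finally show ?thesis .
    qed
    then show "\<exists>M. \<forall>m\<ge>M. \<forall>n\<ge>M. dist (s m) (s n) < e" by blast
  qed
  then obtain L where L: "s \<longlonglongrightarrow> L" using Cauchy_convergent convergent_def by blast
  then have suminf: "(\<Sum>i. fps_nth F i * z ^ i) = L"
    unfolding s_def by (intro sums_unique[symmetric]) (simp add: sums_def)
  have Ltail: "absv (L - s M) \<le> absv z ^ M" for M
  proof -
    have "absv z ^ M > 0" using z by (simp add: absv_pos)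
    then obtain N0 where N0: "\<And>N. N \<ge> N0 \<Longrightarrow> dist (s N) L < absv z ^ M"
      using L unfolding lim_sequentially by blast
    define N where "N = max N0 M"
    have "absv (L - s N) < absv z ^ M"
      using N0[of N] by (simp add: N_def dist_absv absv_diff_commute)
    moreover have "absv (s N - s M) \<le> absv z ^ M" by (rule tail) (simp add: N_def)
    ultimately show ?thesis using absv_add_le_max[of "L - s N" "s N - s M"] by simp
  qed
  define U where "U = Abs_fps (\<lambda>m. (L - s (Suc m)) / z ^ Suc m)"
  have "integral_fps U"
    unfolding integral_fps_def U_def fps_nth_Abs_fps
  proof
    fix m
    have "absv z ^ Suc m > 0" using z by (simp add: absv_pos)
    then show "absv ((L - s (Suc m)) / z ^ Suc m) \<le> 1"
      using Ltail[of "Suc m"] by (simp only: absv_divide absv_power divide_le_eq_1_pos)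
  qed
  moreover have "F = fps_const L + (fps_X - fps_const z) * U"
  proof (rule fps_ext)
    fix n
    have zU: "z * fps_nth U m = (L - s (Suc m)) / z ^ m" for m
      using z by (simp add: U_def)
    show "fps_nth F n = fps_nth (fps_const L + (fps_X - fps_const z) * U) n"
    proof (cases n)
      case 0
      then show ?thesis using zU[of 0] by (simp add: left_diff_distrib s_def)
    next
      case (Suc k)
      have "fps_nth (fps_const L + (fps_X - fps_const z) * U) n = fps_nth U k - z * fps_nth U (Suc k)"
        by (simp add: Suc left_diff_distrib)
      also have "\<dots> = (s (Suc (Suc k)) - s (Suc k)) / z ^ Suc k"
        unfolding zU by (simp add: U_def flip: diff_divide_distrib)
      also have "\<dots> = fps_nth F n"
        using z by (simp add: s_def Suc)
      finally show ?thesis by simp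
    qed
  qed
  ultimately show ?thesis unfolding has_value_def suminf by blast
qed

text \<open>Value zero at \<open>z\<close> is divisibility by \<open>X - z\<close> with integral
  cofactor. The cofactor still vanishes at every other zero \<open>w\<close>, because
  \<open>w - z\<close> is nonzero.\<close>

lemma integral_fps_zeros_factor:
  fixes h :: "'a::complete_ultrametric_field fps"
  assumes "finite S" "integral_fps h" "\<And>z. z \<in> S \<Longrightarrow> z \<noteq> 0 \<and> absv z < 1 \<and> has_value z h 0"
  shows "\<exists>u. integral_fps u \<and> h = (\<Prod>z\<in>S. fps_X - fps_const z) * u"
  using assms
proof (induction S arbitrary: h rule: finite_induct)
  case empty
  then show ?case by (intro exI[of _ h]) simp
next
  case (insert z S)
  then obtain v where v: "integral_fps v" "h = (fps_X - fps_const z) * v"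
    unfolding has_value_def by auto
  have "has_value w v 0" if w: "w \<in> S" for w
  proof -
    have w1: "w \<noteq> 0" "absv w < 1" "has_value w h 0" "absv z < 1" using insert.prems w by auto
    obtain d where d: "has_value w v d" using has_value_suminf[OF v(1) w1(2,1)] by blast
    have "has_value w h ((w - z) * d)"
      unfolding v(2)
      by (intro has_value_mult has_value_diff has_value_X has_value_const d v integral_fps_diff
          integral_fps_X integral_fps_const) (use w1 in auto)
    then have "(w - z) * d = 0" using has_value_unique w1 by blast
    then show ?thesis using d insert.hyps w by auto
  qed
  then obtain u where "integral_fps u" "v = (\<Prod>z\<in>S. fps_X - fps_const z) * u"
    using insert.IH[OF v(1)] insert.prems by blast
  then show ?case using v insert.hyps by (intro exI[of _ u]) (simp add: mult.assoc)
qed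

subsection \<open>The action on the completion\<close>

definition fps_image :: "('a::zero \<Rightarrow> 'b::zero) \<Rightarrow> 'a fps \<Rightarrow> 'b fps" where
  "fps_image \<iota> F = Abs_fps (\<lambda>i. \<iota> (fps_nth F i))"

lemma fps_image_nth [simp]: "fps_nth (fps_image \<iota> F) i = \<iota> (fps_nth F i)"
  by (simp add: fps_image_def)

locale ultrametric_completion =
  fixes \<iota> :: "'k::ultrametric_field \<Rightarrow> 'K::complete_ultrametric_field"
  assumes completion: "is_completion \<iota>"
begin

lemma \<iota>_add: "\<iota> (x + y) = \<iota> x + \<iota> y" and \<iota>_mult: "\<iota> (x * y) = \<iota> x * \<iota> y"
  and \<iota>_1 [simp]: "\<iota> 1 = 1" and absv_\<iota> [simp]: "absv (\<iota> x) = absv x"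
  using completion by (auto simp: is_completion_def)

lemma \<iota>_0 [simp]: "\<iota> 0 = 0"
  using absv_\<iota>[of 0] by (simp del: absv_\<iota>)

lemma \<iota>_eq_0_iff [simp]: "\<iota> x = 0 \<longleftrightarrow> x = 0"
  using absv_\<iota>[of x] by (metis absv_eq_0_iff)

lemma \<iota>_diff: "\<iota> (x - y) = \<iota> x - \<iota> y"
  using \<iota>_add[of "x - y" y] by simp

lemma \<iota>_sum: "\<iota> (sum g A) = (\<Sum>a\<in>A. \<iota> (g a))"
  by (induction A rule: infinite_finite_induct) (auto simp: \<iota>_add)

lemma fps_image_diff: "fps_image \<iota> (F - G) = fps_image \<iota> F - fps_image \<iota> G"
  by (rule fps_ext) (simp add: \<iota>_diff)

lemma fps_image_mult: "fps_image \<iota> (F * G) = fps_image \<iota> F * fps_image \<iota> G"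
  by (rule fps_ext) (simp add: fps_mult_nth \<iota>_sum \<iota>_mult)

lemma fps_image_1 [simp]: "fps_image \<iota> 1 = 1"
  by (rule fps_ext) simp

lemma fps_image_X [simp]: "fps_image \<iota> fps_X = fps_X"
  by (rule fps_ext) simp

lemma fps_image_power: "fps_image \<iota> (F ^ n) = fps_image \<iota> F ^ n"
  by (induction n) (auto simp: fps_image_mult)

lemma fps_image_compose: "fps_image \<iota> (F oo G) = fps_image \<iota> F oo fps_image \<iota> G"
  by (rule fps_ext) (simp add: fps_compose_nth \<iota>_sum \<iota>_mult flip: fps_image_power)

lemma integral_fps_image: "integral_fps F \<Longrightarrow> integral_fps (fps_image \<iota> F)"
  by (simp add: integral_fps_def)

lemma fps_action_has_value:
  assumes "integral_fps f" "absv z < 1" "z \<noteq> 0"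
  shows "has_value z (fps_image \<iota> f) (fps_action \<iota> f z)"
  using has_value_suminf[OF integral_fps_image[OF assms(1)] assms(2,3)]
  by (simp add: fps_action_def)

lemma fps_action_0: "fps_nth f 0 = 0 \<Longrightarrow> fps_action \<iota> f 0 = 0"
proof -
  assume "fps_nth f 0 = 0"
  then have "(\<lambda>i. \<iota> (fps_nth f i) * 0 ^ i) = (\<lambda>i. 0)" by (auto simp: power_0_left)
  then show ?thesis unfolding fps_action_def by simp
qed

text \<open>Identifies iterating the action with evaluating the formal iterate. The absolute value
  is carried along in the induction to keep the orbit nonzero and inside the open disc.\<close>

lemma fps_action_iterate:
  assumes f: "integral_fps f" "fps_nth f 0 = 0" "absv (fps_nth f 1) = 1" and z: "absv z < 1" "z \<noteq> 0"
  shows "absv ((fps_action \<iota> f ^^ j) z) = absv z \<and>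
    has_value z (fps_image \<iota> (fps_iterate f j)) ((fps_action \<iota> f ^^ j) z)"
proof (induction j)
  case 0
  then show ?case by (simp add: has_value_X)
next
  case (Suc j)
  define w where "w = (fps_action \<iota> f ^^ j) z"
  have w: "absv w = absv z" "has_value z (fps_image \<iota> (fps_iterate f j)) w"
    using Suc by (auto simp: w_def)
  have w1: "absv w < 1" "w \<noteq> 0" using w z by auto
  have v: "has_value w (fps_image \<iota> f) (fps_action \<iota> f w)"
    by (rule fps_action_has_value[OF f(1) w1])
  have "absv (fps_action \<iota> f w) = absv w"
    by (rule has_value_isometry[OF v integral_fps_image[OF f(1)]]) (use f w1 in auto)
  moreover have "has_value z (fps_image \<iota> f oo fps_image \<iota> (fps_iterate f j)) (fps_action \<iota> f w)"
    by (rule has_value_compose[OF v w(2)]) (use f in \<open>auto intro: integral_fps_image integral_fps_iterate\<close>)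
  ultimately show ?case using w by (simp add: w_def fps_iterate_Suc fps_image_compose)
qed

end

section \<open>Cycles and the zeros they produce\<close>

lemma has_minimal_period_inj_on:
  assumes "has_minimal_period F M x"
  shows "inj_on (\<lambda>j. (F ^^ j) x) {..<M}"
proof -
  have no: "(F ^^ i) x \<noteq> (F ^^ j) x" if "i < j" "j < M" for i j
  proof
    assume "(F ^^ i) x = (F ^^ j) x"
    then have "(F ^^ (M - j)) ((F ^^ i) x) = (F ^^ (M - j)) ((F ^^ j) x)" by simp
    then have "(F ^^ (M - j + i)) x = (F ^^ M) x"
      using that by (simp flip: comp_apply[of "F ^^ _" "F ^^ _"] funpow_add)
    then have "(F ^^ (M - j + i)) x = x"
      using assms by (simp add: has_minimal_period_def)
    moreover have "0 < M - j + i" "M - j + i < M" using that by auto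
    ultimately show False using assms unfolding has_minimal_period_def by blast
  qed
  show ?thesis
    unfolding inj_on_def by (metis no lessThan_iff linorder_neqE_nat)
qed

lemma has_minimal_period_funpow_neq:
  assumes "has_minimal_period F M x" "0 < m" "m < M" "j < M"
  shows "(F ^^ m) ((F ^^ j) x) \<noteq> (F ^^ j) x"
proof
  assume "(F ^^ m) ((F ^^ j) x) = (F ^^ j) x"
  then have "(F ^^ (M - j)) ((F ^^ m) ((F ^^ j) x)) = (F ^^ (M - j)) ((F ^^ j) x)" by simp
  then have "(F ^^ (M - j + (m + j))) x = (F ^^ (M - j + j)) x"
    by (simp only: funpow_add comp_apply)
  moreover have "(F ^^ (M - j + (m + j))) x = (F ^^ m) ((F ^^ M) x)"
  proof -
    have "M - j + (m + j) = m + M" using assms by simp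
    then show ?thesis by (simp only: funpow_add comp_apply)
  qed
  ultimately have "(F ^^ m) x = x"
    using assms by (simp add: has_minimal_period_def)
  then show False using assms by (simp add: has_minimal_period_def)
qed

context ultrametric_completion
begin

text \<open>For the integral quotient \<open>h\<close> of \<open>f^(m k) - X\<close> by
  \<open>f^m - X\<close>, the leading coefficient is the quotient of the two coefficients compared
  here. The \<open>m k\<close> points of the cycle are distinct zeros of \<open>h\<close> of
  absolute value \<open>absv z\<close>.\<close>

lemma minimal_period_bound:
  fixes f :: "'k fps"
  assumes f: "integral_fps f" "fps_nth f 0 = 0" "absv (fps_nth f 1) = 1"
    and z: "absv z < 1" and m: "m > 0" "k > 1"
    and per: "has_minimal_period (fps_action \<iota> f) (m * k) (\<iota> z)"
    and P: "near_id s (fps_iterate f m)" "s \<ge> 1" "fps_nth (fps_iterate f m) (s + 1) \<noteq> 0"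
    and Q: "near_id t (fps_iterate f (m * k))" "t \<ge> 1"
  shows "absv (fps_nth (fps_iterate f (m * k)) (t + 1)) \<le>
    absv (fps_nth (fps_iterate f m) (s + 1)) * absv z ^ (m * k)"
proof (cases "fps_nth (fps_iterate f (m * k)) (t + 1) = 0")
  case False
  define M where "M = m * k"
  define F where "F = fps_action \<iota> f"
  have mM: "0 < m" "m < M" using m by (auto simp: M_def)
  have z0: "z \<noteq> 0"
  proof
    assume "z = 0"
    then have "(F ^^ m) (\<iota> z) = \<iota> z"
      using fps_action_0[OF f(2)] by (induction m) (auto simp: F_def)
    then show False using per mM by (simp add: has_minimal_period_def F_def M_def)
  qed
  define orb where "orb = (\<lambda>j. (F ^^ j) (\<iota> z))"
  have orb: "absv (orb j) = absv z" for j
    using fps_action_iterate[OF f, of "\<iota> z" j] z z0 by (simp add: orb_def F_def)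
  have orb01: "absv (orb j) < 1" "orb j \<noteq> 0" for j
    using orb[of j] z z0 by auto
  have val: "has_value (orb j) (fps_image \<iota> (fps_iterate f l)) ((F ^^ l) (orb j))" for j l
    using fps_action_iterate[OF f orb01, of l j] by (simp add: F_def)
  obtain h where h: "integral_fps h"
    "fps_iterate (fps_iterate f m) k - fps_X = (fps_iterate f m - fps_X) * h"
    using integral_iterate_minus_dvd[OF integral_fps_iterate[OF f(1)], of m k] f(2) by auto
  then have hM: "fps_iterate f M - fps_X = (fps_iterate f m - fps_X) * h"
    using f(2) by (simp add: M_def fps_iterate_mult)
  \<comment> \<open>At a point of the cycle \<open>f^(m k) - X\<close> vanishes but
    \<open>f^m - X\<close> does not, as \<open>m\<close> is smaller than the minimal period; so
    \<open>h\<close> must vanish.\<close>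
  have zero: "has_value (orb j) (fps_image \<iota> h) 0" if j: "j < M" for j
  proof -
    obtain d where d: "has_value (orb j) (fps_image \<iota> h) d"
      using has_value_suminf[OF integral_fps_image[OF h(1)] orb01] by blast
    have "has_value (orb j) (fps_image \<iota> (fps_iterate f M - fps_X)) (((F ^^ m) (orb j) - orb j) * d)"
      unfolding hM fps_image_mult fps_image_diff fps_image_X
      by (intro has_value_mult has_value_diff val has_value_X d integral_fps_diff integral_fps_image
          integral_fps_iterate f h integral_fps_X) (use orb01[of j] in auto)
    moreover have "has_value (orb j) (fps_image \<iota> (fps_iterate f M - fps_X)) ((F ^^ M) (orb j) - orb j)"
      unfolding fps_image_diff fps_image_X by (intro has_value_diff val has_value_X)
    ultimately have "((F ^^ m) (orb j) - orb j) * d = (F ^^ M) (orb j) - orb j"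
      using has_value_unique orb01 by blast
    moreover have "(F ^^ M) (orb j) = orb j"
    proof -
      have "(F ^^ M) (orb j) = (F ^^ j) ((F ^^ M) (\<iota> z))"
        by (metis orb_def funpow_add comp_apply add.commute)
      then show ?thesis using per by (simp add: has_minimal_period_def F_def M_def orb_def)
    qed
    moreover have "(F ^^ m) (orb j) \<noteq> orb j"
      unfolding orb_def
      by (rule has_minimal_period_funpow_neq[OF _ mM j]) (use per in \<open>simp add: F_def M_def\<close>)
    ultimately have "d = 0" by simp
    then show ?thesis using d by simp
  qed
  define S where "S = orb ` {..<M}"
  have injS: "inj_on orb {..<M}"
    unfolding orb_def by (rule has_minimal_period_inj_on) (use per in \<open>simp add: F_def M_def\<close>)
  obtain u where u: "integral_fps u" "fps_image \<iota> h = (\<Prod>w\<in>S. fps_X - fps_const w) * u"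
  proof -
    have "finite S" by (simp add: S_def)
    moreover have "w \<noteq> 0 \<and> absv w < 1 \<and> has_value w (fps_image \<iota> h) 0" if "w \<in> S" for w
      using that zero orb01 unfolding S_def by auto
    ultimately show ?thesis
      using integral_fps_zeros_factor[OF _ integral_fps_image[OF h(1)], of S] that by blast
  qed
  define W where "W = (\<Prod>w\<in>S. fps_X - fps_const w)"
  have "fps_nth W 0 = (\<Prod>w\<in>S. - w)"
  proof -
    have "finite T \<Longrightarrow> fps_nth (\<Prod>w\<in>T. fps_X - fps_const w) 0 = (\<Prod>w\<in>T. - w)" for T :: "'K set"
      by (induction rule: finite_induct) auto
    then show ?thesis by (simp add: W_def S_def)
  qed
  then have "absv (fps_nth W 0) = (\<Prod>w\<in>S. absv w)"
    by (simp add: absv_prod S_def)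
  also have "\<dots> = absv z ^ M"
    unfolding S_def by (simp add: prod.reindex[OF injS] orb)
  finally have W_0: "absv (fps_nth W 0) = absv z ^ M" .
  have W_ne: "fps_nth W 0 \<noteq> 0" using W_0 z0 by (metis absv_eq_0_iff power_eq_0_iff)
  define e d where "e = fps_nth (fps_iterate f M) (t + 1)" and "d = fps_nth (fps_iterate f m) (s + 1)"
  have e0: "e \<noteq> 0" using False by (simp add: e_def M_def)
  have sQ: "subdegree (fps_iterate f M - fps_X) = t + 1"
    using Q e0 by (intro subdegreeI) (auto simp: near_id_def M_def e_def)
  have sP: "subdegree (fps_iterate f m - fps_X) = s + 1"
    using P by (intro subdegreeI) (auto simp: near_id_def)
  have h0: "h \<noteq> 0" and P0: "fps_iterate f m - fps_X \<noteq> 0"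
    using hM sQ by auto
  define l where "l = subdegree h"
  have tsl: "t + 1 = (s + 1) + l"
    using subdegree_mult[OF P0 h0] hM sQ sP by (simp add: l_def)
  have "e = fps_nth ((fps_iterate f m - fps_X) * h) (subdegree (fps_iterate f m - fps_X) + subdegree h)"
    using Q(2) unfolding hM[symmetric] sP l_def[symmetric] tsl[symmetric] by (simp add: e_def)
  also have "\<dots> = fps_nth (fps_iterate f m - fps_X) (subdegree (fps_iterate f m - fps_X)) *
      fps_nth h (subdegree h)"
    by (rule nth_subdegree_mult)
  also have "\<dots> = d * fps_nth h l"
    using P(2) unfolding sP l_def[symmetric] by (simp add: d_def)
  finally have ed: "e = d * fps_nth h l" .
  have sh: "subdegree (fps_image \<iota> h) = l"
    using h0 by (intro subdegreeI) (auto simp: l_def)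
  have "u \<noteq> 0" using u(2) h0 nth_subdegree_nonzero[OF h0] by (metis \<iota>_eq_0_iff fps_image_nth fps_zero_nth mult_zero_right)
  moreover have "W \<noteq> 0" "subdegree W = 0" using W_ne by auto
  ultimately have su: "subdegree u = l"
    using subdegree_mult[of W u] u(2) sh by (simp add: W_def)
  \<comment> \<open>The product \<open>W\<close> of the linear factors has nonzero constant term, so
    it leaves the order unchanged and scales the leading coefficient by that term.\<close>
  have "\<iota> (fps_nth h l) = fps_nth W 0 * fps_nth u l"
    using nth_subdegree_mult[of W u] \<open>subdegree W = 0\<close> su u(2) by (metis W_def add_0 fps_image_nth)
  then have "absv (fps_nth h l) = absv z ^ M * absv (fps_nth u l)"
    by (metis W_0 absv_\<iota> absv_mult)
  also have "\<dots> \<le> absv z ^ M"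
    using integral_fps_nth[OF u(1), of l] by (simp add: mult_left_le)
  finally have "absv e \<le> absv d * absv z ^ M"
    unfolding ed absv_mult by (intro mult_left_mono) auto
  then show ?thesis by (simp add: e_def d_def M_def)
qed simp

end

section \<open>Extraction of roots and the final estimate\<close>

lemma powr_mult_powr_le:
  fixes A B x :: real
  assumes "A > 0" "B > 0" "x \<ge> 0" "M > 0" "A ^ u * B ^ v \<le> x ^ M"
  shows "A powr (real u / real M) * B powr (real v / real M) \<le> x"
proof -
  have "(A powr (real u / real M)) ^ M = A ^ u" "(B powr (real v / real M)) ^ M = B ^ v"
    using assms by (simp_all add: powr_power powr_realpow)
  then have "(A powr (real u / real M) * B powr (real v / real M)) ^ M \<le> x ^ M"
    using assms by (simp add: power_mult_distrib)
  then show ?thesis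
    using assms(3,4) power_mono_iff[of "A powr (real u / real M) * B powr (real v / real M)" x M] by simp
qed

theorem theoremB:
  fixes f :: "'k::ultrametric_field fps"
    and \<iota> :: "'k \<Rightarrow> 'K::complete_ultrametric_field"
    and p q n :: nat
    and \<zeta>\<^sub>0 :: 'k
  assumes "prime p" and "CHAR('k) = p"
    and "is_completion \<iota>"
    and "parabolic f" and "\<forall>i. fps_nth f i \<in> integer_ring"
    and "q = root_order (fps_nth f 1)"
    and "i0 (fps_iterate f q) = enat q"
    and "n \<ge> 1"
    and "\<zeta>\<^sub>0 \<in> maximal_ideal"
    and "has_minimal_period (fps_action \<iota> f) (q * p ^ n) (\<iota> \<zeta>\<^sub>0)"
  shows "(odd p \<or> (p = 2 \<and> n = 1) \<longrightarrow>
            absv \<zeta>\<^sub>0 \<ge> absv (fps_nth (fps_iterate f q) (q + 1)) powr (1 / real q)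
                       * absv (resit f) powr (1 / real (q * p))) \<and>
         (p = 2 \<and> n \<ge> 2 \<longrightarrow>
            absv \<zeta>\<^sub>0 \<ge> absv (fps_nth (fps_iterate f q) (q + 1)) powr (1 / real q)
                       * absv (resit f * (1 - resit f)) powr (1 / real (4 * q)))"
proof -
  interpret ultrametric_completion \<iota> by unfold_locales (rule assms)
  note p = assms(1,2)
  have p2: "p \<ge> 2" using p prime_ge_2_nat by blast
  obtain N where f0: "fps_nth f 0 = 0" and N: "N > 0" "fps_nth f 1 ^ N = 1"
    using assms(4) unfolding parabolic_def by blast
  have q0: "q > 0" and pq: "\<not> p dvd q"
    using root_order[OF N] root_order_coprime_CHAR[OF p N] by (auto simp: assms(6))
  have fI: "integral_fps f" using assms(5) by (simp add: integral_fps_def integer_ring_def)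
  have f1: "absv (fps_nth f 1) = 1" by (rule absv_of_power_eq_1[OF N(2,1)])
  have z: "absv \<zeta>\<^sub>0 < 1" using assms(9) by (simp add: maximal_ideal_def)
  obtain g c where gc: "near_id 1 g" "fps_nth g 2 \<noteq> 0" "c \<noteq> 0"
    "of_nat q * (1 - fps_nth g 3 / (fps_nth g 2)\<^sup>2) = resit f"
    "\<And>n. near_id (q * ramif p n) (fps_iterate f (q * p ^ n))"
    "\<And>n. fps_nth (fps_iterate f (q * p ^ n)) (q * ramif p n + 1) = lead g p n * c ^ ramif p n"
    using parabolic_lead[OF p assms(4,6,7)] by blast
  define r where "r = 1 - fps_nth g 3 / (fps_nth g 2)\<^sup>2"
  define D where "D = (\<lambda>n. fps_nth (fps_iterate f (q * p ^ n)) (q * ramif p n + 1))"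
  define \<delta> where "\<delta> = absv (fps_nth (fps_iterate f q) (q + 1))"
  have D: "D n = lead g p n * c ^ ramif p n" for n unfolding D_def by (rule gc(6))
  have D0: "D 0 = fps_nth g 2 * c" using D[of 0] near_id_0[OF gc(1)] by (simp add: lead_0)
  have \<delta>: "\<delta> = absv (D 0)" "\<delta> > 0" "D 0 \<noteq> 0"
    using D0 gc(2,3) by (auto simp: \<delta>_def D_def intro!: absv_pos)
  have c_ramif: "c ^ ramif p (Suc n) = c ^ (p ^ Suc n) * c ^ ramif p n" for n
    by (simp add: ramif_Suc' power_add)
  \<comment> \<open>The increment of \<open>ramif\<close> is \<open>p ^ Suc n\<close>, so the new
    powers of \<open>c\<close> combine with those of the quadratic coefficient of \<open>g\<close>
    into a power of \<open>D 0\<close>.\<close>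
  have ratio: "D (Suc n) = D 0 ^ (p ^ Suc n) * r ^ (p ^ n) * D n" if "odd p \<or> n = 0" for n
    using lead_ratio(1)[OF p gc(1,2) that] unfolding D D0[unfolded D] c_ramif r_def[symmetric]
    by (simp add: power_mult_distrib D0[unfolded D] mult_ac)
  have ratio2: "D (Suc (Suc n)) = D 0 ^ (p ^ Suc (Suc n)) * (r * (1 - r)) ^ (2 ^ n) * D (Suc n)" if "p = 2" for n
    using lead_ratio(2)[OF p gc(1,2) that, of n] that unfolding D D0[unfolded D] c_ramif r_def[symmetric]
    by (simp add: power_mult_distrib D0[unfolded D] mult_ac)
  have bound: "absv (D (Suc j)) \<le> absv (D j) * absv \<zeta>\<^sub>0 ^ (q * p ^ Suc j)" if "n = Suc j" "D j \<noteq> 0" for j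
  proof -
    have e: "q * p ^ j * p = q * p ^ Suc j" by simp
    have s1: "q * ramif p i \<ge> 1" for i using q0 ramif_pos[of p i] by (simp add: Suc_le_eq)
    have "absv (fps_nth (fps_iterate f (q * p ^ j * p)) (q * ramif p (Suc j) + 1)) \<le>
        absv (fps_nth (fps_iterate f (q * p ^ j)) (q * ramif p j + 1)) * absv \<zeta>\<^sub>0 ^ (q * p ^ j * p)"
    proof (rule minimal_period_bound[OF fI f0 f1 z _ _ _ gc(5) s1 _ _ s1])
      show "q * p ^ j > 0" "p > 1" using q0 p2 by auto
      show "has_minimal_period (fps_action \<iota> f) (q * p ^ j * p) (\<iota> \<zeta>\<^sub>0)"
        unfolding e using assms(10) that(1) by simp
      show "fps_nth (fps_iterate f (q * p ^ j)) (q * ramif p j + 1) \<noteq> 0"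
        using that(2) by (simp only: D_def) simp
      show "near_id (q * ramif p (Suc j)) (fps_iterate f (q * p ^ j * p))"
        unfolding e by (rule gc(5))
    qed
    then show ?thesis unfolding e D_def .
  qed
  \<comment> \<open>By Fermat's little theorem \<open>q\<close> is a root of unity in the field.
    Hence \<open>resit f = q r\<close> and \<open>r\<close> have the same absolute value.\<close>
  have qabs: "absv (of_nat q :: 'k) = 1"
  proof -
    have "[1 = q ^ (p - 1)] (mod p)" using fermat_theorem[OF p(1) pq] by (rule cong_sym)
    moreover have "q ^ (p - 1) \<ge> 1" using q0 by (simp add: Suc_le_eq)
    ultimately have "p dvd q ^ (p - 1) - 1" by (simp only: cong_altdef_nat cong_sym_eq[of 1])
    then have "of_nat (q ^ (p - 1) - 1) = (0 :: 'k)"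
      using p of_nat_eq_0_iff_char_dvd by blast
    then have "(of_nat q :: 'k) ^ (p - 1) = 1"
      using \<open>q ^ (p - 1) \<ge> 1\<close> by (simp add: of_nat_diff)
    then show ?thesis using p2 by (intro absv_of_power_eq_1[of _ "p - 1"]) auto
  qed
  then have rabs: "absv (resit f) = absv r"
    using gc(4) by (metis absv_mult mult_1 r_def)
  show ?thesis
  proof (intro conjI impI)
    assume o: "odd p \<or> (p = 2 \<and> n = 1)"
    obtain j where j: "n = Suc j" using assms(8) by (cases n) auto
    show "absv (fps_nth (fps_iterate f q) (q + 1)) powr (1 / real q) * absv (resit f) powr (1 / real (q * p)) \<le> absv \<zeta>\<^sub>0"
    \<comment> \<open>For \<open>r = 0\<close> the asserted bound is \<open>0\<close>, since
      \<open>0 powr x = 0\<close>. Otherwise \<open>D j\<close> is nonzero and can be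
      cancelled.\<close>
    proof (cases "r = 0")
      case False
      have nz: "D i \<noteq> 0" if "odd p \<or> i = 0" for i
        using that by (induction i) (use ratio \<delta> False in auto)
      have oj: "odd p \<or> j = 0" using o j by auto
      have "\<delta> ^ (p ^ Suc j) * absv r ^ (p ^ j) * absv (D j) \<le> absv \<zeta>\<^sub>0 ^ (q * p ^ Suc j) * absv (D j)"
        using bound[OF j nz[OF oj]] unfolding ratio[OF oj] \<delta>(1) by (simp add: absv_mult absv_power mult_ac)
      then have "\<delta> ^ (p ^ Suc j) * absv r ^ (p ^ j) \<le> absv \<zeta>\<^sub>0 ^ (q * p ^ Suc j)"
        using absv_pos[OF nz[OF oj]] by simp
      then have "\<delta> powr (real (p ^ Suc j) / real (q * p ^ Suc j)) * absv r powr (real (p ^ j) / real (q * p ^ Suc j)) \<le> absv \<zeta>\<^sub>0"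
        using \<delta>(2) absv_pos[OF False] q0 p2 by (intro powr_mult_powr_le) auto
      moreover have "real (p ^ Suc j) / real (q * p ^ Suc j) = 1 / real q"
        "real (p ^ j) / real (q * p ^ Suc j) = 1 / real (q * p)"
        using p2 by (simp_all add: field_simps)
      ultimately show ?thesis by (simp only: rabs \<delta>_def)
    qed (simp add: rabs)
  next
    assume o: "p = 2 \<and> n \<ge> 2"
    then have pe: "p = 2" by simp
    obtain j where j: "n = Suc (Suc j)" using o by (metis Suc_le_D numeral_2_eq_2 Suc_le_mono)
    \<comment> \<open>Equality of absolute values would not control \<open>1 - r\<close>; for
      \<open>p = 2\<close> the odd number \<open>q\<close> equals \<open>1\<close> in the
      field.\<close>
    have "r = resit f"
    proof -
      obtain m where "q = 2 * m + 1" using pq pe by (metis oddE)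
      moreover have "(2::'k) = 0" using p pe by (metis of_nat_CHAR of_nat_numeral)
      ultimately have "of_nat q = (1::'k)" by simp
      then show ?thesis using gc(4) by (simp add: r_def)
    qed
    then have res: "resit f * (1 - resit f) = r * (1 - r)" by simp
    show "absv (fps_nth (fps_iterate f q) (q + 1)) powr (1 / real q) * absv (resit f * (1 - resit f)) powr (1 / real (4 * q)) \<le> absv \<zeta>\<^sub>0"
    proof (cases "r * (1 - r) = 0")
      case False
      have nz: "D (Suc i) \<noteq> 0" for i
      proof (induction i)
        case 0
        show ?case using ratio[of 0] \<delta> False by auto
      next
        case (Suc i)
        then show ?case using ratio2[OF pe, of i] \<delta> False by auto
      qed
      \<comment> \<open>With \<open>n = j + 2\<close> the exponent \<open>2 ^ j\<close> becomes
        \<open>1 / (4 q)\<close> after the root of order \<open>q 2^n\<close> is taken.\<close>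
      have "\<delta> ^ (p ^ n) * absv (r * (1 - r)) ^ (2 ^ j) * absv (D (Suc j)) \<le> absv \<zeta>\<^sub>0 ^ (q * p ^ n) * absv (D (Suc j))"
        using bound[OF j nz] unfolding ratio2[OF pe] \<delta>(1) j by (simp only: absv_mult absv_power mult_ac)
      then have "\<delta> ^ (p ^ n) * absv (r * (1 - r)) ^ (2 ^ j) \<le> absv \<zeta>\<^sub>0 ^ (q * p ^ n)"
        using absv_pos[OF nz] mult_le_cancel_right_pos by blast
      then have "\<delta> powr (real (p ^ n) / real (q * p ^ n)) * absv (r * (1 - r)) powr (real (2 ^ j) / real (q * p ^ n)) \<le> absv \<zeta>\<^sub>0"
        using \<delta>(2) absv_pos[OF False] q0 p2 by (intro powr_mult_powr_le) auto
      moreover have "real (p ^ n) / real (q * p ^ n) = 1 / real q"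
        "real (2 ^ j) / real (q * p ^ n) = 1 / real (4 * q)"
        using p2 by (simp_all add: field_simps pe j)
      ultimately show ?thesis by (simp only: res \<delta>_def)
    qed (simp only: res, simp)
  qed
qed

end
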